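(* Let $G$ be a finite group, let $S\in\mathrm{Syl}_p(G)$ for some prime $p$, and let $\mathcal F=\mathcal F_S(G)$ be the fusion system on $S$ induced by $G$. Then the image of the restriction map $B(\mathrm{Res}^G_S):B(G)\to B(S)$ is $B(\mathcal F)$.
   Context: For a finite group $G$, $B(G)$ is the Burnside ring, i.e. the Grothendieck ring of finite left $G$-sets, with addition $[X]+[Y]=[X\sqcup Y]$ and multiplication $[X][Y]=[X\times Y]$. For $H\leq G$, the map $[X]\mapsto|X^H|$ extends to a ring morphism $B(G)\to\mathbb Z$, written $a\mapsto|a^H|$. For $H\leq G$, $B(\mathrm{Res}^G_H):B(G)\to B(H)$ is the ring morphism restricting the action to $H$. For $S\in\mathrm{Syl}_p(G)$, $\mathcal F_S(G)$ is the category with objects the subgroups of $S$ and with $\mathrm{Hom}_{\mathcal F_S(G)}(P,Q)=\mathrm{Hom}_G(P,Q)$, the set of homomorphisms $P\to Q$ given by conjugation by an element of $G$. The Burnside ring of $\mathcal F=\mathcal F_S(G)$ is the subring $B(\mathcal F)\subseteq B(S)$ of all $a\in B(S)$ such that $|a^P|=|a^Q|$ whenever $P,Q\leq S$ are isomorphic in $\mathcal F$, i.e. conjugate in $G$. *)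

theory Defs
  imports "HOL-Algebra.Sylow" "HOL-Algebra.Group_Action" "HOL-Algebra.Subrings"
    "HOL-Algebra.IntRing"
begin

section \<open>Finite \<open>G\<close>-sets\<close>

type_synonym ('g, 'a) gset = "'a set \<times> ('g \<Rightarrow> 'a \<Rightarrow> 'a)"

definition fin_gset :: "('g, 'm) monoid_scheme \<Rightarrow> ('g, 'a) gset \<Rightarrow> bool" where
  "fin_gset G X \<longleftrightarrow> finite (fst X) \<and> group_action G (fst X) (snd X)"

definition gset_iso :: "('g, 'm) monoid_scheme \<Rightarrow> ('g, 'a) gset \<Rightarrow> ('g, 'b) gset \<Rightarrow> bool" where
  "gset_iso G X Y \<longleftrightarrow> (\<exists>f. bij_betw f (fst X) (fst Y) \<and>
     (\<forall>g\<in>carrier G. \<forall>x\<in>fst X. f (snd X g x) = snd Y g (f x)))"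

text \<open>The restrictions are there because \<^const>\<open>BijGroup\<close> consists of extensional functions.\<close>

definition gset_sum :: "('g, 'a) gset \<Rightarrow> ('g, 'b) gset \<Rightarrow> ('g, 'a + 'b) gset" where
  "gset_sum X Y =
     (fst X <+> fst Y, \<lambda>g. restrict (map_sum (snd X g) (snd Y g)) (fst X <+> fst Y))"

definition gset_prod :: "('g, 'a) gset \<Rightarrow> ('g, 'b) gset \<Rightarrow> ('g, 'a \<times> 'b) gset" where
  "gset_prod X Y =
     (fst X \<times> fst Y, \<lambda>g. restrict (map_prod (snd X g) (snd Y g)) (fst X \<times> fst Y))"

definition gset_empty :: "('g, 'a) gset" where
  "gset_empty = ({}, \<lambda>g. \<lambda>x\<in>{}. x)"

definition gset_point :: "('g, unit) gset" where
  "gset_point = ({()}, \<lambda>g. \<lambda>x\<in>{()}. x)"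

definition gset_fixed :: "'g set \<Rightarrow> ('g, 'a) gset \<Rightarrow> 'a set" where
  "gset_fixed H X = {x \<in> fst X. \<forall>h\<in>H. snd X h x = x}"


section \<open>The Burnside ring\<close>

text \<open>
  A pair \<open>(A, B)\<close> of finite \<open>G\<close>-sets represents the formal difference \<open>[A] - [B]\<close>. Every finite
  \<open>G\<close>-set is isomorphic to one whose points are natural numbers, so those suffice as
  representatives; \<open>gset_class G X Y\<close> is nevertheless defined for \<open>G\<close>-sets \<open>X\<close>, \<open>Y\<close> on any types:
  it is the element \<open>[X] - [Y]\<close> of the Grothendieck group, i.e. the set of all \<open>(A, B)\<close> with
  \<open>X \<squnion> B \<squnion> Z \<cong> A \<squnion> Y \<squnion> Z\<close> for some \<open>Z\<close>.
\<close>

type_synonym 'g burnside = "(('g, nat) gset \<times> ('g, nat) gset) set"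

definition gset_class ::
    "('g, 'm) monoid_scheme \<Rightarrow> ('g, 'a) gset \<Rightarrow> ('g, 'b) gset \<Rightarrow> 'g burnside" where
  "gset_class G X Y = {(A, B). fin_gset G A \<and> fin_gset G B \<and>
     (\<exists>Z :: ('g, nat) gset. fin_gset G Z \<and>
        gset_iso G (gset_sum (gset_sum X B) Z) (gset_sum (gset_sum A Y) Z))}"

definition burnside_ring :: "('g, 'm) monoid_scheme \<Rightarrow> 'g burnside ring" where
  "burnside_ring G =
     \<lparr>carrier = {gset_class G A B | (A :: ('g, nat) gset) (B :: ('g, nat) gset).
        fin_gset G A \<and> fin_gset G B},
      monoid.mult = (\<lambda>a b. \<Union>(A, B)\<in>a. \<Union>(C, D)\<in>b.
        gset_class G (gset_sum (gset_prod A C) (gset_prod B D))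
                     (gset_sum (gset_prod A D) (gset_prod B C))),
      one = gset_class G gset_point (gset_empty :: ('g, unit) gset),
      zero = gset_class G (gset_empty :: ('g, unit) gset) (gset_empty :: ('g, unit) gset),
      add = (\<lambda>a b. \<Union>(A, B)\<in>a. \<Union>(C, D)\<in>b. gset_class G (gset_sum A C) (gset_sum B D))\<rparr>"

text \<open>The mark \<open>a \<mapsto> |a\<^sup>H|\<close>; the image below is a singleton, by \<open>burnside_mark_class\<close>.\<close>

definition burnside_mark :: "'g set \<Rightarrow> 'g burnside \<Rightarrow> int" where
  "burnside_mark H a =
     the_elem ((\<lambda>(A, B). int (card (gset_fixed H A)) - int (card (gset_fixed H B))) ` a)"

text \<open>
  A \<open>G\<close>-set, as a pair, is literally also an \<open>H\<close>-set for \<open>H \<le> G\<close>: the values of the action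
  outside the acting group are irrelevant. The union below is over equal classes, by
  \<open>burnside_res_class\<close>.
\<close>

definition burnside_res :: "('g, 'm) monoid_scheme \<Rightarrow> 'g set \<Rightarrow> 'g burnside \<Rightarrow> 'g burnside" where
  "burnside_res G H a = (\<Union>(A, B)\<in>a. gset_class (G\<lparr>carrier := H\<rparr>) A B)"


section \<open>Sylow subgroups and fusion systems\<close>

definition sylow_subgroup :: "('g, 'm) monoid_scheme \<Rightarrow> nat \<Rightarrow> 'g set \<Rightarrow> bool" where
  "sylow_subgroup G p S \<longleftrightarrow> subgroup S G \<and> card S = p ^ multiplicity p (order G)"

record 'g fusion_category =
  Ob :: "'g set set"
  Hom :: "'g set \<Rightarrow> 'g set \<Rightarrow> ('g \<Rightarrow> 'g) set"

definition fusion_system :: "('g, 'm) monoid_scheme \<Rightarrow> 'g set \<Rightarrow> 'g fusion_category" where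
  "fusion_system G S =
     \<lparr>Ob = {P. subgroup P (G\<lparr>carrier := S\<rparr>)},
      Hom = (\<lambda>P Q. {restrict (\<lambda>x. g \<otimes>\<^bsub>G\<^esub> x \<otimes>\<^bsub>G\<^esub> inv\<^bsub>G\<^esub> g) P | g.
        g \<in> carrier G \<and> (\<forall>x\<in>P. g \<otimes>\<^bsub>G\<^esub> x \<otimes>\<^bsub>G\<^esub> inv\<^bsub>G\<^esub> g \<in> Q)})\<rparr>"

definition fusion_iso :: "'g fusion_category \<Rightarrow> 'g set \<Rightarrow> 'g set \<Rightarrow> bool" where
  "fusion_iso F P Q \<longleftrightarrow> (\<exists>\<phi>\<in>Hom F P Q. \<exists>\<psi>\<in>Hom F Q P.
     compose P \<psi> \<phi> = restrict id P \<and> compose Q \<phi> \<psi> = restrict id Q)"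

text \<open>\<open>B(\<F>)\<close> as a subset of \<open>B(S)\<close>; the first argument is the group \<open>S\<close>.\<close>

definition burnside_fusion ::
    "('g, 'm) monoid_scheme \<Rightarrow> 'g fusion_category \<Rightarrow> 'g burnside set" where
  "burnside_fusion S F = {a \<in> carrier (burnside_ring S).
     \<forall>P\<in>Ob F. \<forall>Q\<in>Ob F. fusion_iso F P Q \<longrightarrow> burnside_mark P a = burnside_mark Q a}"


section \<open>Well-definedness\<close>


lemma fin_gsetI:
  assumes "group G" "finite E"
    and cl: "\<And>g x. g \<in> carrier G \<Longrightarrow> x \<in> E \<Longrightarrow> a g x \<in> E"
    and ext: "\<And>g. g \<in> carrier G \<Longrightarrow> a g \<in> extensional E"
    and one: "\<And>x. x \<in> E \<Longrightarrow> a \<one>\<^bsub>G\<^esub> x = x"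
    and mul: "\<And>g h x. g \<in> carrier G \<Longrightarrow> h \<in> carrier G \<Longrightarrow> x \<in> E \<Longrightarrow>
      a (g \<otimes>\<^bsub>G\<^esub> h) x = a g (a h x)"
  shows "fin_gset G (E, a)"
proof -
  interpret group G by fact
  have bij: "a g \<in> Bij E" if "g \<in> carrier G" for g
  proof -
    have "bij_betw (a g) E E"
      by (rule bij_betw_byWitness[where f' = "a (inv\<^bsub>G\<^esub> g)"])
         (use that in \<open>auto simp: cl one mul[symmetric]\<close>)
    then show ?thesis using ext that by (simp add: Bij_def)
  qed
  have "a \<in> hom G (BijGroup E)"
  proof (rule homI)
    fix g h assume g: "g \<in> carrier G" and h: "h \<in> carrier G"
    have "a (g \<otimes>\<^bsub>G\<^esub> h) = compose E (a g) (a h)"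
      by (rule extensionalityI[where A = E]) (use g h ext mul in \<open>auto simp: compose_eq\<close>)
    then show "a (g \<otimes>\<^bsub>G\<^esub> h) = a g \<otimes>\<^bsub>BijGroup E\<^esub> a h"
      using bij g h by (simp add: BijGroup_def)
  qed (simp add: BijGroup_def bij)
  then show ?thesis
    using assms(1,2) group_BijGroup[of E]
    by (simp add: fin_gset_def group_action_def group_hom_def group_hom_axioms_def)
qed

lemma fin_gsetD:
  assumes "fin_gset G A"
  shows "group G" "finite (fst A)"
    "\<And>g x. g \<in> carrier G \<Longrightarrow> x \<in> fst A \<Longrightarrow> snd A g x \<in> fst A"
    "\<And>g. g \<in> carrier G \<Longrightarrow> snd A g \<in> extensional (fst A)"
    "\<And>x. x \<in> fst A \<Longrightarrow> snd A \<one>\<^bsub>G\<^esub> x = x"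
    "\<And>g h x. g \<in> carrier G \<Longrightarrow> h \<in> carrier G \<Longrightarrow> x \<in> fst A \<Longrightarrow>
      snd A (g \<otimes>\<^bsub>G\<^esub> h) x = snd A g (snd A h x)"
proof -
  interpret group_action G "fst A" "snd A" using assms by (simp add: fin_gset_def)
  show "group G" using group_hom by (simp add: group_hom_def)
  show "finite (fst A)" using assms by (simp add: fin_gset_def)
  show "snd A g x \<in> fst A" if "g \<in> carrier G" "x \<in> fst A" for g x
    using element_image that by blast
  show "snd A g \<in> extensional (fst A)" if "g \<in> carrier G" for g
    using bij_prop0[OF that] by (simp add: Bij_def)
  show "snd A \<one>\<^bsub>G\<^esub> x = x" if "x \<in> fst A" for x
    using id_eq_one that by (metis restrict_apply')
  show "snd A (g \<otimes>\<^bsub>G\<^esub> h) x = snd A g (snd A h x)"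
    if "g \<in> carrier G" "h \<in> carrier G" "x \<in> fst A" for g h x
    using composition_rule that by blast
qed

lemma fin_gset_sum: "fin_gset G A \<Longrightarrow> fin_gset G B \<Longrightarrow> fin_gset G (gset_sum A B)"
  unfolding gset_sum_def
  by (rule fin_gsetI) (auto simp: fin_gsetD)

lemma fin_gset_prod: "fin_gset G A \<Longrightarrow> fin_gset G B \<Longrightarrow> fin_gset G (gset_prod A B)"
  unfolding gset_prod_def
  by (rule fin_gsetI) (auto simp: fin_gsetD)

lemma fin_gset_empty: "group G \<Longrightarrow> fin_gset G gset_empty"
  unfolding gset_empty_def by (rule fin_gsetI) auto

lemma fin_gset_point: "group G \<Longrightarrow> fin_gset G gset_point"
  unfolding gset_point_def by (rule fin_gsetI) auto

lemma fin_gset_res: "fin_gset G A \<Longrightarrow> subgroup H G \<Longrightarrow> fin_gset (G\<lparr>carrier := H\<rparr>) A"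
proof -
  assume A: "fin_gset G A" and H: "subgroup H G"
  have "fin_gset (G\<lparr>carrier := H\<rparr>) (fst A, snd A)"
    using subgroup.mem_carrier[OF H]
    by (intro fin_gsetI) (use A H in \<open>auto simp: fin_gsetD group.subgroup_imp_group\<close>)
  then show ?thesis by simp
qed

lemma gset_isoI:
  assumes "bij_betw f (fst A) (fst B)"
    "\<And>g x. g \<in> carrier G \<Longrightarrow> x \<in> fst A \<Longrightarrow> f (snd A g x) = snd B g (f x)"
  shows "gset_iso G A B"
  using assms by (auto simp: gset_iso_def)

lemma gset_isoI2:
  assumes "\<And>x. x \<in> fst A \<Longrightarrow> f x \<in> fst B \<and> f' (f x) = x"
    "\<And>x. x \<in> fst B \<Longrightarrow> f' x \<in> fst A \<and> f (f' x) = x"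
    "\<And>g x. g \<in> carrier G \<Longrightarrow> x \<in> fst A \<Longrightarrow> f (snd A g x) = snd B g (f x)"
  shows "gset_iso G A B"
  by (rule gset_isoI[of f, OF bij_betw_byWitness[where f' = f']]) (use assms in auto)

lemma gset_isoE:
  assumes "gset_iso G A B"
  obtains f where "bij_betw f (fst A) (fst B)"
    "\<And>g x. g \<in> carrier G \<Longrightarrow> x \<in> fst A \<Longrightarrow> f (snd A g x) = snd B g (f x)"
  using assms by (auto simp: gset_iso_def)

lemma gset_isoE2:
  assumes "gset_iso G A B"
  obtains f f' where "\<And>x. x \<in> fst A \<Longrightarrow> f x \<in> fst B"  "\<And>x. x \<in> fst A \<Longrightarrow> f' (f x) = x"
    "\<And>x. x \<in> fst B \<Longrightarrow> f' x \<in> fst A" "\<And>x. x \<in> fst B \<Longrightarrow> f (f' x) = x"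
    "\<And>g x. g \<in> carrier G \<Longrightarrow> x \<in> fst A \<Longrightarrow> f (snd A g x) = snd B g (f x)"
proof -
  obtain f where f: "bij_betw f (fst A) (fst B)"
    "\<And>g x. g \<in> carrier G \<Longrightarrow> x \<in> fst A \<Longrightarrow> f (snd A g x) = snd B g (f x)"
    using gset_isoE[OF assms] by blast
  show ?thesis
    by (rule that[of f "inv_into (fst A) f"])
      (use f in \<open>simp_all add: bij_betw_apply bij_betw_inv_into_left bij_betw_inv_into_right
         bij_betw_apply[OF bij_betw_inv_into]\<close>)
qed

lemma gset_iso_refl: "gset_iso G A A"
  by (rule gset_isoI[of id]) auto

lemma gset_iso_sym:
  assumes "fin_gset G A" "gset_iso G A B" shows "gset_iso G B A"
proof -
  obtain f where f: "bij_betw f (fst A) (fst B)"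
    "\<And>g x. g \<in> carrier G \<Longrightarrow> x \<in> fst A \<Longrightarrow> f (snd A g x) = snd B g (f x)"
    using assms(2) by (auto simp: gset_iso_def)
  show ?thesis
  proof (rule gset_isoI)
    show "bij_betw (inv_into (fst A) f) (fst B) (fst A)" using f(1) by (rule bij_betw_inv_into)
    fix g x assume g: "g \<in> carrier G" and x: "x \<in> fst B"
    then obtain y where y: "y \<in> fst A" "x = f y" using f(1) by (auto simp: bij_betw_def)
    then show "inv_into (fst A) f (snd B g x) = snd A g (inv_into (fst A) f x)"
      using f g fin_gsetD(3)[OF assms(1)]
      by (metis bij_betw_inv_into_left)
  qed
qed

lemma gset_iso_trans:
  assumes "gset_iso G A B" "gset_iso G B C" shows "gset_iso G A C"
proof -
  obtain f where f: "bij_betw f (fst A) (fst B)"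
    "\<And>g x. g \<in> carrier G \<Longrightarrow> x \<in> fst A \<Longrightarrow> f (snd A g x) = snd B g (f x)"
    using gset_isoE[OF assms(1)] by blast
  obtain h where h: "bij_betw h (fst B) (fst C)"
    "\<And>g x. g \<in> carrier G \<Longrightarrow> x \<in> fst B \<Longrightarrow> h (snd B g x) = snd C g (h x)"
    using gset_isoE[OF assms(2)] by blast
  have "h (f (snd A g x)) = snd C g (h (f x))" if "g \<in> carrier G" "x \<in> fst A" for g x
    using f(2)[OF that] h(2)[OF that(1) bij_betw_apply[OF f(1) that(2)]] by simp
  then show ?thesis
    by (intro gset_isoI[of "h \<circ> f"] bij_betw_trans[OF f(1) h(1)]) auto
qed

lemma gset_nat:
  assumes "fin_gset G A"
  obtains B :: "('g, nat) gset" where "fin_gset (G :: ('g, 'm) monoid_scheme) B" "gset_iso G A B"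
proof -
  note A = fin_gsetD[OF assms]
  obtain f :: "_ \<Rightarrow> nat" where f: "inj_on f (fst A)"
    using A(2) finite_imp_inj_to_nat_seg by blast
  define k where "k = inv_into (fst A) f"
  have k: "k (f x) = x" if "x \<in> fst A" for x using f that by (simp add: k_def)
  define B where "B = (f ` fst A, \<lambda>g. \<lambda>x\<in>f ` fst A. f (snd A g (k x)))"
  have k': "k y \<in> fst A" "f (k y) = y" if "y \<in> f ` fst A" for y using that k by auto
  have "fin_gset G B" unfolding B_def
    by (rule fin_gsetI) (simp_all add: A k k')
  moreover have "gset_iso G A B"
    by (rule gset_isoI[of f]) (auto simp: B_def bij_betw_def f k)
  ultimately show ?thesis by (rule that)
qed

lemma gset_sum_cong:
  assumes "gset_iso G A A'" "gset_iso G B B'"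
  shows "gset_iso G (gset_sum A B) (gset_sum A' B')"
proof -
  obtain f f' where f: "\<And>x. x \<in> fst A \<Longrightarrow> f x \<in> fst A'"  "\<And>x. x \<in> fst A \<Longrightarrow> f' (f x) = x"
    "\<And>x. x \<in> fst A' \<Longrightarrow> f' x \<in> fst A" "\<And>x. x \<in> fst A' \<Longrightarrow> f (f' x) = x"
    "\<And>g x. g \<in> carrier G \<Longrightarrow> x \<in> fst A \<Longrightarrow> f (snd A g x) = snd A' g (f x)"
    using gset_isoE2[OF assms(1)] by blast
  obtain h h' where h: "\<And>x. x \<in> fst B \<Longrightarrow> h x \<in> fst B'"  "\<And>x. x \<in> fst B \<Longrightarrow> h' (h x) = x"
    "\<And>x. x \<in> fst B' \<Longrightarrow> h' x \<in> fst B" "\<And>x. x \<in> fst B' \<Longrightarrow> h (h' x) = x"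
    "\<And>g x. g \<in> carrier G \<Longrightarrow> x \<in> fst B \<Longrightarrow> h (snd B g x) = snd B' g (h x)"
    using gset_isoE2[OF assms(2)] by blast
  show ?thesis
    by (rule gset_isoI2[where f = "map_sum f h" and f' = "map_sum f' h'"])
      (auto simp: gset_sum_def f h)
qed

lemma gset_prod_cong:
  assumes "gset_iso G A A'" "gset_iso G B B'"
  shows "gset_iso G (gset_prod A B) (gset_prod A' B')"
proof -
  obtain f f' where f: "\<And>x. x \<in> fst A \<Longrightarrow> f x \<in> fst A'"  "\<And>x. x \<in> fst A \<Longrightarrow> f' (f x) = x"
    "\<And>x. x \<in> fst A' \<Longrightarrow> f' x \<in> fst A" "\<And>x. x \<in> fst A' \<Longrightarrow> f (f' x) = x"
    "\<And>g x. g \<in> carrier G \<Longrightarrow> x \<in> fst A \<Longrightarrow> f (snd A g x) = snd A' g (f x)"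
    using gset_isoE2[OF assms(1)] by blast
  obtain h h' where h: "\<And>x. x \<in> fst B \<Longrightarrow> h x \<in> fst B'"  "\<And>x. x \<in> fst B \<Longrightarrow> h' (h x) = x"
    "\<And>x. x \<in> fst B' \<Longrightarrow> h' x \<in> fst B" "\<And>x. x \<in> fst B' \<Longrightarrow> h (h' x) = x"
    "\<And>g x. g \<in> carrier G \<Longrightarrow> x \<in> fst B \<Longrightarrow> h (snd B g x) = snd B' g (h x)"
    using gset_isoE2[OF assms(2)] by blast
  show ?thesis
    by (rule gset_isoI2[where f = "map_prod f h" and f' = "map_prod f' h'"])
      (auto simp: gset_prod_def f h)
qed

text \<open>
  \<open>isum\<close> and \<open>iprod\<close> are the operations on isomorphism classes; together with \<open>geq\<close> they reduce
  the ring laws to identities in a commutative semiring.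
\<close>

definition icls :: "('g, 'm) monoid_scheme \<Rightarrow> ('g, 'a) gset \<Rightarrow> ('g, nat) gset set" where
  "icls G A = {B. fin_gset G B \<and> gset_iso G A B}"

definition isum :: "('g, 'm) monoid_scheme \<Rightarrow> ('g, nat) gset set \<Rightarrow> ('g, nat) gset set \<Rightarrow> ('g, nat) gset set" where
  "isum G a b = {C. fin_gset G C \<and> (\<exists>A\<in>a. \<exists>B\<in>b. fin_gset G A \<and> fin_gset G B \<and> gset_iso G (gset_sum A B) C)}"

definition iprod :: "('g, 'm) monoid_scheme \<Rightarrow> ('g, nat) gset set \<Rightarrow> ('g, nat) gset set \<Rightarrow> ('g, nat) gset set" where
  "iprod G a b = {C. fin_gset G C \<and> (\<exists>A\<in>a. \<exists>B\<in>b. fin_gset G A \<and> fin_gset G B \<and> gset_iso G (gset_prod A B) C)}"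

lemma icls_eq_iff:
  assumes "fin_gset G A" "fin_gset G B"
  shows "icls G A = icls G B \<longleftrightarrow> gset_iso G A B"
proof
  assume e: "icls G A = icls G B"
  obtain C :: "(_, nat) gset" where C: "fin_gset G C" "gset_iso G A C" using gset_nat[OF assms(1)] by blast
  then have "C \<in> icls G B" using e by (auto simp: icls_def)
  then show "gset_iso G A B"
    using C assms by (auto simp: icls_def intro: gset_iso_trans gset_iso_sym)
next
  assume i: "gset_iso G A B"
  have "gset_iso G A C = gset_iso G B C" for C :: "('a, nat) gset"
    using gset_iso_trans[OF i, of C] gset_iso_trans[OF gset_iso_sym[OF assms(1) i], of C] by blast
  then show "icls G A = icls G B"
    by (simp add: icls_def)
qed

lemma icls_sum:
  assumes "fin_gset G A" "fin_gset G B"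
  shows "icls G (gset_sum A B) = isum G (icls G A) (icls G B)"
proof (intro equalityI subsetI)
  obtain A' :: "(_, nat) gset" where A: "fin_gset G A'" "gset_iso G A A'" using gset_nat[OF assms(1)] by blast
  obtain B' :: "(_, nat) gset" where B: "fin_gset G B'" "gset_iso G B B'" using gset_nat[OF assms(2)] by blast
  note i = gset_sum_cong[OF A(2) B(2)]
  note i' = gset_iso_sym[OF fin_gset_sum[OF assms] i]
  fix C
  {
    assume C: "C \<in> icls G (gset_sum A B)"
    then have "gset_iso G (gset_sum A' B') C" "fin_gset G C"
      using gset_iso_trans[OF i', of C] by (simp_all add: icls_def)
    then show "C \<in> isum G (icls G A) (icls G B)"
      unfolding icls_def isum_def using A B by blast
  }
  assume "C \<in> isum G (icls G A) (icls G B)"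
  then obtain A1 B1 :: "('a, nat) gset" where 1: "gset_iso G A A1" "gset_iso G B B1" "gset_iso G (gset_sum A1 B1) C" "fin_gset G C"
    unfolding icls_def isum_def by auto
  then show "C \<in> icls G (gset_sum A B)"
    using gset_iso_trans[OF gset_sum_cong[OF 1(1,2)] 1(3)] by (simp add: icls_def)
qed

lemma icls_prod:
  assumes "fin_gset G A" "fin_gset G B"
  shows "icls G (gset_prod A B) = iprod G (icls G A) (icls G B)"
proof (intro equalityI subsetI)
  obtain A' :: "(_, nat) gset" where A: "fin_gset G A'" "gset_iso G A A'" using gset_nat[OF assms(1)] by blast
  obtain B' :: "(_, nat) gset" where B: "fin_gset G B'" "gset_iso G B B'" using gset_nat[OF assms(2)] by blast
  note i = gset_prod_cong[OF A(2) B(2)]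
  note i' = gset_iso_sym[OF fin_gset_prod[OF assms] i]
  fix C
  {
    assume C: "C \<in> icls G (gset_prod A B)"
    then have "gset_iso G (gset_prod A' B') C" "fin_gset G C"
      using gset_iso_trans[OF i', of C] by (simp_all add: icls_def)
    then show "C \<in> iprod G (icls G A) (icls G B)"
      unfolding icls_def iprod_def using A B by blast
  }
  assume "C \<in> iprod G (icls G A) (icls G B)"
  then obtain A1 B1 :: "('a, nat) gset" where 1: "gset_iso G A A1" "gset_iso G B B1" "gset_iso G (gset_prod A1 B1) C" "fin_gset G C"
    unfolding icls_def iprod_def by auto
  then show "C \<in> icls G (gset_prod A B)"
    using gset_iso_trans[OF gset_prod_cong[OF 1(1,2)] 1(3)] by (simp add: icls_def)
qed

lemma iso_sum_comm: "gset_iso G (gset_sum A B) (gset_sum B A)"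
  by (rule gset_isoI2[where f = "case_sum Inr Inl" and f' = "case_sum Inr Inl"])
     (auto simp: gset_sum_def)

lemma iso_sum_assoc:
  "fin_gset G A \<Longrightarrow> fin_gset G B \<Longrightarrow> fin_gset G C \<Longrightarrow>
  gset_iso G (gset_sum (gset_sum A B) C) (gset_sum A (gset_sum B C))"
  by (rule gset_isoI2[where f = "case_sum (case_sum Inl (Inr \<circ> Inl)) (Inr \<circ> Inr)"
       and f' = "case_sum (Inl \<circ> Inl) (case_sum (Inl \<circ> Inr) Inr)"])
     (auto simp: gset_sum_def fin_gsetD)

lemma iso_sum_empty: "gset_iso G (gset_sum (gset_empty :: ('g,'a) gset) A) A"
  by (rule gset_isoI2[where f = "case_sum undefined id" and f' = Inr])
     (auto simp: gset_sum_def gset_empty_def)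

lemma iso_prod_comm: "gset_iso G (gset_prod A B) (gset_prod B A)"
  by (rule gset_isoI2[where f = prod.swap and f' = prod.swap]) (auto simp: gset_prod_def)

lemma iso_prod_assoc:
  "fin_gset G A \<Longrightarrow> fin_gset G B \<Longrightarrow> fin_gset G C \<Longrightarrow>
  gset_iso G (gset_prod (gset_prod A B) C) (gset_prod A (gset_prod B C))"
  by (rule gset_isoI2[where f = "\<lambda>((a,b),c). (a,b,c)" and f' = "\<lambda>(a,b,c). ((a,b),c)"])
     (auto simp: gset_prod_def fin_gsetD)

lemma iso_prod_point: "gset_iso G (gset_prod gset_point A) A"
  by (rule gset_isoI2[where f = snd and f' = "Pair ()"]) (auto simp: gset_prod_def gset_point_def)

lemma iso_prod_empty:
  "gset_iso G (gset_prod (gset_empty :: ('g,'a) gset) A) (gset_empty :: ('g,'b) gset)"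
  by (rule gset_isoI2[where f = undefined and f' = undefined])
    (auto simp: gset_prod_def gset_empty_def)

lemma iso_distrib:
  "fin_gset G A \<Longrightarrow> fin_gset G B \<Longrightarrow> fin_gset G C \<Longrightarrow>
  gset_iso G (gset_prod (gset_sum A B) C) (gset_sum (gset_prod A C) (gset_prod B C))"
  by (rule gset_isoI2[where f = "\<lambda>(s,c). map_sum (\<lambda>a. (a,c)) (\<lambda>b. (b,c)) s"
       and f' = "case_sum (\<lambda>(a,c). (Inl a,c)) (\<lambda>(b,c). (Inr b,c))"])
     (auto simp: gset_sum_def gset_prod_def fin_gsetD)


lemma isum_comm: "isum G a b = isum G b a"
  unfolding isum_def using gset_iso_trans[OF iso_sum_comm] by blast

lemma isum_assoc_aux:
  "isum G (isum G a b) c = {D. fin_gset G D \<and> (\<exists>A\<in>a. \<exists>B\<in>b. \<exists>C\<in>c. fin_gset G A \<and> fin_gset G B \<and>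
     fin_gset G C \<and> gset_iso G (gset_sum (gset_sum A B) C) D)}" (is "_ = ?R")
proof (intro equalityI subsetI)
  fix D assume "D \<in> isum G (isum G a b) c"
  then obtain E A B C :: "('a, nat) gset" where *: "A \<in> a" "B \<in> b" "C \<in> c" "fin_gset G A" "fin_gset G B" "fin_gset G C"
    "fin_gset G D" "gset_iso G (gset_sum A B) E" "gset_iso G (gset_sum E C) D"
    unfolding isum_def by blast
  have "gset_iso G (gset_sum (gset_sum A B) C) D"
    using gset_iso_trans[OF gset_sum_cong[OF *(8) gset_iso_refl] *(9)] .
  with * show "D \<in> ?R" by blast
next
  fix D assume "D \<in> ?R"
  then obtain A B C :: "('a, nat) gset" where *: "A \<in> a" "B \<in> b" "C \<in> c" "fin_gset G A" "fin_gset G B" "fin_gset G C"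
    "fin_gset G D" "gset_iso G (gset_sum (gset_sum A B) C) D" by blast
  obtain E :: "(_, nat) gset" where E: "fin_gset G E" "gset_iso G (gset_sum A B) E"
    using gset_nat[OF fin_gset_sum[OF *(4,5)]] by blast
  have "gset_iso G (gset_sum E C) D"
    using gset_iso_trans[OF gset_sum_cong[OF gset_iso_sym[OF fin_gset_sum[OF *(4,5)] E(2)] gset_iso_refl] *(8)] .
  with * E show "D \<in> isum G (isum G a b) c" unfolding isum_def by blast
qed

lemma isum_assoc: "isum G (isum G a b) c = isum G a (isum G b c)"
proof -
  have "isum G (isum G a b) c \<subseteq> isum G (isum G b c) a" for a b c
  proof
    fix D assume "D \<in> isum G (isum G a b) c"
    then obtain A B C :: "('a, nat) gset" where *: "A \<in> a" "B \<in> b" "C \<in> c" "fin_gset G A" "fin_gset G B" "fin_gset G C"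
      "fin_gset G D" "gset_iso G (gset_sum (gset_sum A B) C) D" unfolding isum_assoc_aux by blast
    have f: "fin_gset G (gset_sum (gset_sum A B) C)" using * by (simp add: fin_gset_sum)
    have "gset_iso G (gset_sum (gset_sum A B) C) (gset_sum (gset_sum B C) A)"
      using gset_iso_trans[OF iso_sum_assoc[OF *(4-6)] iso_sum_comm] .
    then have "gset_iso G (gset_sum (gset_sum B C) A) D"
      using gset_iso_trans[OF gset_iso_sym[OF f] *(8)] by blast
    with * show "D \<in> isum G (isum G b c) a" unfolding isum_assoc_aux by blast
  qed
  from this[of a b c] this[of b c a] this[of c a b]
  have "isum G (isum G a b) c = isum G (isum G b c) a" by (simp add: subset_antisym)
  then show ?thesis by (simp add: isum_comm)
qed

lemma isum_lcomm: "isum G b (isum G a c) = isum G a (isum G b c)"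
  by (metis isum_assoc isum_comm)

lemmas isum_ac = isum_assoc isum_comm isum_lcomm

lemma iprod_comm: "iprod G a b = iprod G b a"
  unfolding iprod_def using gset_iso_trans[OF iso_prod_comm] by blast

lemma icls_distrib:
  assumes "fin_gset G A" "fin_gset G B" "fin_gset G C"
  shows "iprod G (isum G (icls G A) (icls G B)) (icls G C) =
    isum G (iprod G (icls G A) (icls G C)) (iprod G (icls G B) (icls G C))"
  using icls_eq_iff[THEN iffD2, OF _ _ iso_distrib[OF assms]] assms
  by (simp add: fin_gset_sum fin_gset_prod icls_sum icls_prod)

lemma icls_prod_assoc:
  assumes "fin_gset G A" "fin_gset G B" "fin_gset G C"
  shows "iprod G (iprod G (icls G A) (icls G B)) (icls G C) =
    iprod G (icls G A) (iprod G (icls G B) (icls G C))"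
  using icls_eq_iff[THEN iffD2, OF _ _ iso_prod_assoc[OF assms]] assms
  by (simp add: fin_gset_sum fin_gset_prod icls_sum icls_prod)

definition geq where
  "geq G x y x' y' \<longleftrightarrow> (\<exists>Z :: ('g, nat) gset. fin_gset (G :: ('g,'m) monoid_scheme) Z \<and>
     isum G (isum G x y') (icls G Z) = isum G (isum G x' y) (icls G Z))"

lemma gset_iso_sum3_iff:
  assumes "fin_gset G X" "fin_gset G Y" "fin_gset G A" "fin_gset G B" "fin_gset G Z"
  shows "gset_iso G (gset_sum (gset_sum X B) Z) (gset_sum (gset_sum A Y) Z) \<longleftrightarrow>
    isum G (isum G (icls G X) (icls G B)) (icls G Z) = isum G (isum G (icls G A) (icls G Y)) (icls G Z)"
  using icls_eq_iff[of G "gset_sum (gset_sum X B) Z" "gset_sum (gset_sum A Y) Z"] assms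
  by (simp add: fin_gset_sum icls_sum)

lemma class_iff:
  assumes "fin_gset G X" "fin_gset G Y"
  shows "(A, B) \<in> gset_class G X Y \<longleftrightarrow> fin_gset G A \<and> fin_gset G B \<and>
    geq G (icls G X) (icls G Y) (icls G A) (icls G B)"
  unfolding gset_class_def geq_def using gset_iso_sum3_iff[OF assms] by blast

lemma geq_refl:
  assumes "group G" shows "geq G x y x y"
  unfolding geq_def using fin_gset_empty[OF assms] by blast

lemma geq_sym: "geq G x y x' y' \<Longrightarrow> geq G x' y' x y"
  unfolding geq_def by metis

lemma geq_trans:
  assumes "geq G (icls G X) (icls G Y) (icls G X') (icls G Y')"
    "geq G (icls G X') (icls G Y') (icls G X'') (icls G Y'')"
    "fin_gset G X'" "fin_gset G Y'"
  shows "geq G (icls G X) (icls G Y) (icls G X'') (icls G Y'')"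
proof -
  obtain Z :: "(_, nat) gset" where Z: "fin_gset G Z"
     "isum G (isum G (icls G X) (icls G Y')) (icls G Z) = isum G (isum G (icls G X') (icls G Y)) (icls G Z)"
    using assms(1) geq_def by blast
  obtain W :: "(_, nat) gset" where W: "fin_gset G W"
     "isum G (isum G (icls G X') (icls G Y'')) (icls G W) = isum G (isum G (icls G X'') (icls G Y')) (icls G W)"
    using assms(2) geq_def by blast
  let ?V = "gset_sum (gset_sum X' Y') (gset_sum Z W)"
  have V: "fin_gset G ?V" using assms(3,4) Z W by (simp add: fin_gset_sum)
  obtain V :: "(_, nat) gset" where VV: "fin_gset G V" "gset_iso G ?V V" using gset_nat[OF V] by blast
  have e: "icls G V = isum G (isum G (icls G X') (icls G Y')) (isum G (icls G Z) (icls G W))"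
    using icls_eq_iff[OF V VV(1)] VV(2) assms(3,4) Z W by (simp add: fin_gset_sum icls_sum)
  have "isum G (isum G (icls G X) (icls G Y'')) (icls G V) =
     isum G (isum G (isum G (icls G X) (icls G Y')) (icls G Z)) (isum G (isum G (icls G X') (icls G Y'')) (icls G W))"
    by (simp add: e isum_ac)
  also have "\<dots> = isum G (isum G (icls G X'') (icls G Y)) (icls G V)"
    unfolding Z W by (simp add: e isum_ac)
  finally show ?thesis unfolding geq_def using VV by blast
qed

lemma class_eq_iff:
  assumes "fin_gset G X" "fin_gset G Y" "fin_gset G X'" "fin_gset G Y'"
  shows "gset_class G X Y = gset_class G X' Y' \<longleftrightarrow> geq G (icls G X) (icls G Y) (icls G X') (icls G Y')"
proof
  note gr = fin_gsetD(1)[OF assms(1)]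
  assume e: "gset_class G X Y = gset_class G X' Y'"
  obtain A :: "(_, nat) gset" where A: "fin_gset G A" "gset_iso G X A" using gset_nat[OF assms(1)] by blast
  obtain B :: "(_, nat) gset" where B: "fin_gset G B" "gset_iso G Y B" using gset_nat[OF assms(2)] by blast
  have i: "icls G X = icls G A" "icls G Y = icls G B" using icls_eq_iff A B assms by blast+
  have "(A, B) \<in> gset_class G X Y"
    unfolding class_iff[OF assms(1,2)] i using A B geq_refl[OF gr] by blast
  then show "geq G (icls G X) (icls G Y) (icls G X') (icls G Y')"
    unfolding e class_iff[OF assms(3,4)] i using geq_sym by blast
next
  assume g: "geq G (icls G X) (icls G Y) (icls G X') (icls G Y')"
  have "p \<in> gset_class G X Y \<longleftrightarrow> p \<in> gset_class G X' Y'" for p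
    using geq_trans[OF g _ assms(3,4)] geq_trans[OF geq_sym[OF g] _ assms(1,2)]
      class_iff[OF assms(1,2)] class_iff[OF assms(3,4)] by (cases p) blast
  then show "gset_class G X Y = gset_class G X' Y'" by blast
qed


definition IC :: "('g, 'm) monoid_scheme \<Rightarrow> ('g, nat) gset set set" where
  "IC G = icls G ` {A :: ('g, nat) gset. fin_gset G A}"

lemma icls_IC: assumes "fin_gset G X" shows "icls G X \<in> IC G"
proof -
  obtain A :: "(_, nat) gset" where A: "fin_gset G A" "gset_iso G X A" using gset_nat[OF assms] by blast
  then show ?thesis using icls_eq_iff[OF assms A(1)] by (auto simp: IC_def)
qed

lemma ICE: assumes "x \<in> IC G"
  obtains A :: "('g, nat) gset" where "fin_gset (G :: ('g, 'm) monoid_scheme) A" "x = icls G A"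
  using assms by (auto simp: IC_def)

lemma isum_IC: "x \<in> IC G \<Longrightarrow> y \<in> IC G \<Longrightarrow> isum G x y \<in> IC G"
  by (elim ICE) (simp add: icls_sum[symmetric] icls_IC fin_gset_sum)

lemma iprod_IC: "x \<in> IC G \<Longrightarrow> y \<in> IC G \<Longrightarrow> iprod G x y \<in> IC G"
  by (elim ICE) (simp add: icls_prod[symmetric] icls_IC fin_gset_prod)

lemma IC_distrib: "x \<in> IC G \<Longrightarrow> y \<in> IC G \<Longrightarrow> z \<in> IC G \<Longrightarrow>
   iprod G (isum G x y) z = isum G (iprod G x z) (iprod G y z)"
  by (elim ICE) (simp add: icls_distrib)

lemma IC_distrib2: "x \<in> IC G \<Longrightarrow> y \<in> IC G \<Longrightarrow> z \<in> IC G \<Longrightarrow>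
   iprod G z (isum G x y) = isum G (iprod G z x) (iprod G z y)"
  using IC_distrib iprod_comm by metis

lemma IC_assoc: "x \<in> IC G \<Longrightarrow> y \<in> IC G \<Longrightarrow> z \<in> IC G \<Longrightarrow>
   iprod G (iprod G x y) z = iprod G x (iprod G y z)"
  by (elim ICE) (simp add: icls_prod_assoc)

lemma geq_IC: "geq G x y x' y' \<longleftrightarrow> (\<exists>z\<in>IC G.
     isum G (isum G x y') z = isum G (isum G x' y) z)"
  unfolding geq_def IC_def by blast

lemma geq_trans': "geq G x y x' y' \<Longrightarrow> geq G x' y' x'' y'' \<Longrightarrow> x \<in> IC G \<Longrightarrow> y \<in> IC G \<Longrightarrow>
   x' \<in> IC G \<Longrightarrow> y' \<in> IC G \<Longrightarrow> x'' \<in> IC G \<Longrightarrow> y'' \<in> IC G \<Longrightarrow> geq G x y x'' y''"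
  by (elim ICE, hypsubst, rule geq_trans)

lemma geq_add:
  assumes "geq G x y a b" "geq G u v c d"
  shows "geq G (isum G x u) (isum G y v) (isum G a c) (isum G b d)"
proof -
  obtain z where z: "z \<in> IC G" "isum G (isum G x b) z = isum G (isum G a y) z" using assms(1) geq_IC by blast
  obtain w where w: "w \<in> IC G" "isum G (isum G u d) w = isum G (isum G c v) w" using assms(2) geq_IC by blast
  have "isum G (isum G (isum G x u) (isum G b d)) (isum G z w) =
    isum G (isum G (isum G x b) z) (isum G (isum G u d) w)" by (simp add: isum_ac)
  also have "\<dots> = isum G (isum G (isum G a c) (isum G y v)) (isum G z w)"
    unfolding z w by (simp add: isum_ac)
  finally show ?thesis using geq_IC isum_IC z w by blast
qed

lemma geq_mult1:
  assumes "geq G x y a b" "u \<in> IC G" "v \<in> IC G" "x \<in> IC G" "y \<in> IC G" "a \<in> IC G" "b \<in> IC G"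
  shows "geq G (isum G (iprod G x u) (iprod G y v)) (isum G (iprod G x v) (iprod G y u))
               (isum G (iprod G a u) (iprod G b v)) (isum G (iprod G a v) (iprod G b u))"
proof -
  obtain z where z: "z \<in> IC G" "isum G (isum G x b) z = isum G (isum G a y) z" using assms(1) geq_IC by blast
  let ?l = "isum G (isum G x b) z" and ?r = "isum G (isum G a y) z"
  have "isum G (iprod G ?l u) (iprod G ?r v) = isum G (iprod G ?r u) (iprod G ?l v)"
    by (simp add: z)
  then have "isum G (isum G (isum G (iprod G x u) (iprod G y v)) (isum G (iprod G a v) (iprod G b u)))
         (isum G (iprod G z u) (iprod G z v)) =
     isum G (isum G (isum G (iprod G a u) (iprod G b v)) (isum G (iprod G x v) (iprod G y u)))
         (isum G (iprod G z u) (iprod G z v))"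
    using z(1) assms by (simp add: IC_distrib isum_IC isum_ac)
  then show ?thesis using geq_IC isum_IC iprod_IC z assms by blast
qed

lemma geq_mult:
  assumes "geq G x y a b" "geq G u v c d" and i: "u \<in> IC G" "v \<in> IC G" "x \<in> IC G" "y \<in> IC G"
    "a \<in> IC G" "b \<in> IC G" "c \<in> IC G" "d \<in> IC G"
  shows "geq G (isum G (iprod G x u) (iprod G y v)) (isum G (iprod G x v) (iprod G y u))
               (isum G (iprod G a c) (iprod G b d)) (isum G (iprod G a d) (iprod G b c))"
proof -
  have 1: "geq G (isum G (iprod G x u) (iprod G y v)) (isum G (iprod G x v) (iprod G y u))
               (isum G (iprod G a u) (iprod G b v)) (isum G (iprod G a v) (iprod G b u))"
    using geq_mult1[OF assms(1)] i by blast
  have 2: "geq G (isum G (iprod G a u) (iprod G b v)) (isum G (iprod G a v) (iprod G b u))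
               (isum G (iprod G a c) (iprod G b d)) (isum G (iprod G a d) (iprod G b c))"
    using geq_mult1[OF assms(2) i(5,6,1,2,7,8)] iprod_comm isum_comm by metis
  show ?thesis by (rule geq_trans'[OF 1 2]) (use i in \<open>simp_all add: isum_IC iprod_IC\<close>)
qed

lemma gset_class_nonempty:
  assumes "fin_gset G X" "fin_gset G Y"
  obtains A B where "(A, B) \<in> gset_class G X Y"
proof -
  obtain A :: "(_, nat) gset" where A: "fin_gset G A" "gset_iso G X A" using gset_nat[OF assms(1)] by blast
  obtain B :: "(_, nat) gset" where B: "fin_gset G B" "gset_iso G Y B" using gset_nat[OF assms(2)] by blast
  have i: "icls G X = icls G A" "icls G Y = icls G B" using icls_eq_iff A B assms by blast+
  have "(A, B) \<in> gset_class G X Y"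
    unfolding class_iff[OF assms(1,2)] i using A B geq_refl[OF fin_gsetD(1)[OF A(1)]] by blast
  then show ?thesis by (rule that)
qed

lemma gset_class_memD:
  assumes "fin_gset G X" "fin_gset G Y" "(A, B) \<in> gset_class G X Y"
  shows "fin_gset G A" "fin_gset G B" "geq G (icls G X) (icls G Y) (icls G A) (icls G B)"
    "gset_class G A B = gset_class G X Y"
  using assms class_iff class_eq_iff by blast+

lemma UN_constant_on: "x \<in> A \<Longrightarrow> (\<And>y. y \<in> A \<Longrightarrow> f y = c) \<Longrightarrow> (\<Union>y\<in>A. f y) = c"
  by auto

lemma burnside_add:
  assumes "fin_gset G X" "fin_gset G Y" "fin_gset G U" "fin_gset G V"
  shows "gset_class G X Y \<oplus>\<^bsub>burnside_ring G\<^esub> gset_class G U V = gset_class G (gset_sum X U) (gset_sum Y V)"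
proof -
  have *: "gset_class G (gset_sum A C) (gset_sum B D) = gset_class G (gset_sum X U) (gset_sum Y V)"
    if "(A, B) \<in> gset_class G X Y" "(C, D) \<in> gset_class G U V" for A B C D
    using gset_class_memD[OF assms(1,2) that(1)] gset_class_memD[OF assms(3,4) that(2)] assms
    by (simp add: class_eq_iff fin_gset_sum icls_sum) (metis geq_add geq_sym)
  obtain A B where 1: "(A, B) \<in> gset_class G X Y" using gset_class_nonempty assms by blast
  obtain C D where 2: "(C, D) \<in> gset_class G U V" using gset_class_nonempty assms by blast
  show ?thesis unfolding burnside_ring_def
    using 1 2 * by (auto intro!: UN_constant_on[OF 1] UN_constant_on[OF 2])
qed

lemma burnside_mult:
  assumes "fin_gset G X" "fin_gset G Y" "fin_gset G U" "fin_gset G V"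
  shows "gset_class G X Y \<otimes>\<^bsub>burnside_ring G\<^esub> gset_class G U V =
     gset_class G (gset_sum (gset_prod X U) (gset_prod Y V)) (gset_sum (gset_prod X V) (gset_prod Y U))"
proof -
  have *: "gset_class G (gset_sum (gset_prod A C) (gset_prod B D)) (gset_sum (gset_prod A D) (gset_prod B C)) =
     gset_class G (gset_sum (gset_prod X U) (gset_prod Y V)) (gset_sum (gset_prod X V) (gset_prod Y U))"
    if "(A, B) \<in> gset_class G X Y" "(C, D) \<in> gset_class G U V" for A B C D
  proof -
    note 1 = gset_class_memD[OF assms(1,2) that(1)] and 2 = gset_class_memD[OF assms(3,4) that(2)]
    show ?thesis
      using 1(1,2) 2(1,2) assms
      by (simp add: class_eq_iff fin_gset_sum icls_sum fin_gset_prod icls_prod)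
        (rule geq_mult[OF geq_sym[OF 1(3)] geq_sym[OF 2(3)]]; simp add: icls_IC)
  qed
  obtain A B where 1: "(A, B) \<in> gset_class G X Y" using gset_class_nonempty assms by blast
  obtain C D where 2: "(C, D) \<in> gset_class G U V" using gset_class_nonempty assms by blast
  show ?thesis unfolding burnside_ring_def
    using 1 2 * by (auto intro!: UN_constant_on[OF 1] UN_constant_on[OF 2])
qed

lemma gset_class_carrier:
  assumes "fin_gset G X" "fin_gset G Y"
  shows "gset_class G X Y \<in> carrier (burnside_ring G)"
proof -
  obtain A B where "(A, B) \<in> gset_class G X Y" using gset_class_nonempty assms by blast
  note m = gset_class_memD[OF assms this]
  have "gset_class G A B \<in> carrier (burnside_ring G)"
    unfolding burnside_ring_def using m(1,2) by (simp del: split_paired_Ex) blast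
  then show ?thesis using m(4) by simp
qed

lemma burnside_carrierE:
  assumes "a \<in> carrier (burnside_ring G)"
  obtains A B :: "('g, nat) gset" where "fin_gset (G :: ('g, 'm) monoid_scheme) A" "fin_gset G B" "a = gset_class G A B"
  using assms by (auto simp: burnside_ring_def)

lemma class_eqI:
  assumes "fin_gset G X" "fin_gset G Y" "fin_gset G X'" "fin_gset G Y'"
    "isum G (icls G X) (icls G Y') = isum G (icls G X') (icls G Y)"
  shows "gset_class G X Y = gset_class G X' Y'"
  unfolding class_eq_iff[OF assms(1-4)] geq_def assms(5)
  using fin_gset_empty[OF fin_gsetD(1)[OF assms(1)]] by blast

lemma icls_eqI: "fin_gset G A \<Longrightarrow> fin_gset G B \<Longrightarrow> gset_iso G A B \<Longrightarrow> icls G A = icls G B"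
  by (simp add: icls_eq_iff)

lemma isum_empty:
  fixes G :: "('g, 'm) monoid_scheme"
  assumes "fin_gset G A"
  shows "isum G (icls G (gset_empty :: ('g,'a) gset)) (icls G A) = icls G A"
proof -
  note e = fin_gset_empty[OF fin_gsetD(1)[OF assms]]
  have "icls G (gset_sum (gset_empty :: ('g,'a) gset) A) = icls G A"
    by (intro icls_eqI fin_gset_sum e assms iso_sum_empty)
  then show ?thesis by (simp add: icls_sum e assms)
qed

lemma iprod_empty:
  fixes G :: "('g, 'm) monoid_scheme"
  assumes "fin_gset G A"
  shows "iprod G (icls G (gset_empty :: ('g,'a) gset)) (icls G A) = icls G (gset_empty :: ('g,'a) gset)"
proof -
  note e = fin_gset_empty[OF fin_gsetD(1)[OF assms]]
  have "icls G (gset_prod (gset_empty :: ('g,'a) gset) A) = icls G (gset_empty :: ('g,'a) gset)"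
    by (intro icls_eqI fin_gset_prod e assms iso_prod_empty)
  then show ?thesis by (simp add: icls_prod e assms)
qed

lemma iprod_point:
  assumes "fin_gset G A"
  shows "iprod G (icls G gset_point) (icls G A) = icls G A"
proof -
  note e = fin_gset_point[OF fin_gsetD(1)[OF assms]]
  have "icls G (gset_prod gset_point A) = icls G A"
    by (intro icls_eqI fin_gset_prod e assms iso_prod_point)
  then show ?thesis by (simp add: icls_prod e assms)
qed

lemma burnside_one: "\<one>\<^bsub>burnside_ring G\<^esub> = gset_class G gset_point (gset_empty :: ('g, unit) gset)"
  for G :: "('g, 'm) monoid_scheme"
  by (simp add: burnside_ring_def)

lemma burnside_zero: "\<zero>\<^bsub>burnside_ring G\<^esub> = gset_class G (gset_empty :: ('g, unit) gset) (gset_empty :: ('g, unit) gset)"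
  for G :: "('g, 'm) monoid_scheme"
  by (simp add: burnside_ring_def)


lemmas gs = fin_gset_sum fin_gset_prod fin_gset_empty fin_gset_point icls_sum icls_prod

lemma cring_burnside:
  assumes "group G" shows "cring (burnside_ring G)"
proof (rule cringI)
  let ?R = "burnside_ring G"
  show "abelian_group ?R"
  proof (rule abelian_groupI)
    fix x y z assume x: "x \<in> carrier ?R" and y: "y \<in> carrier ?R"
    show "x \<oplus>\<^bsub>?R\<^esub> y \<in> carrier ?R" using x y
      by (elim burnside_carrierE) (simp add: burnside_add gset_class_carrier gs)
    show "x \<oplus>\<^bsub>?R\<^esub> y = y \<oplus>\<^bsub>?R\<^esub> x" using x y
      by (elim burnside_carrierE) (simp add: burnside_add gs, rule class_eqI; simp add: gs isum_ac)
    show "\<zero>\<^bsub>?R\<^esub> \<oplus>\<^bsub>?R\<^esub> x = x" using x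
      by (elim burnside_carrierE) (simp add: burnside_add burnside_zero gs assms, rule class_eqI;
         simp add: gs assms isum_assoc isum_empty; metis isum_empty isum_lcomm)
    show "\<exists>y\<in>carrier ?R. y \<oplus>\<^bsub>?R\<^esub> x = \<zero>\<^bsub>?R\<^esub>"
    proof -
      obtain A B :: "('a, nat) gset" where A: "fin_gset G A" "fin_gset G B" "x = gset_class G A B"
        using x by (rule burnside_carrierE)
      have "gset_class G B A \<oplus>\<^bsub>?R\<^esub> x = \<zero>\<^bsub>?R\<^esub>"
        unfolding A(3) burnside_add[OF A(2,1,1,2)] burnside_zero
        by (rule class_eqI; simp add: gs assms A isum_ac)
      then show ?thesis using gset_class_carrier[OF A(2,1)] by blast
    qed
    assume z: "z \<in> carrier ?R"
    show "x \<oplus>\<^bsub>?R\<^esub> y \<oplus>\<^bsub>?R\<^esub> z = x \<oplus>\<^bsub>?R\<^esub> (y \<oplus>\<^bsub>?R\<^esub> z)" using x y z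
      by (elim burnside_carrierE) (simp add: burnside_add gs, rule class_eqI; simp add: gs isum_ac)
  next
    show "\<zero>\<^bsub>?R\<^esub> \<in> carrier ?R" by (simp add: burnside_zero gset_class_carrier gs assms)
  qed
  have one: "\<one>\<^bsub>?R\<^esub> \<in> carrier ?R" by (simp add: burnside_one gset_class_carrier gs assms)
  show "comm_monoid ?R"
  proof (rule comm_monoidI)
    fix x y z assume x: "x \<in> carrier ?R" and y: "y \<in> carrier ?R"
    show "x \<otimes>\<^bsub>?R\<^esub> y \<in> carrier ?R" using x y
      by (elim burnside_carrierE) (simp add: burnside_mult gset_class_carrier gs)
    show "x \<otimes>\<^bsub>?R\<^esub> y = y \<otimes>\<^bsub>?R\<^esub> x" using x y
      by (elim burnside_carrierE) (simp add: burnside_mult gs, rule class_eqI; simp add: gs isum_ac iprod_comm)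
    show "\<one>\<^bsub>?R\<^esub> \<otimes>\<^bsub>?R\<^esub> x = x" using x
      by (elim burnside_carrierE) (simp add: burnside_mult burnside_one gs assms, rule class_eqI;
         simp add: gs assms iprod_point iprod_empty isum_ac)
    assume z: "z \<in> carrier ?R"
    show "x \<otimes>\<^bsub>?R\<^esub> y \<otimes>\<^bsub>?R\<^esub> z = x \<otimes>\<^bsub>?R\<^esub> (y \<otimes>\<^bsub>?R\<^esub> z)" using x y z
      by (elim burnside_carrierE) (simp add: burnside_mult gs, rule class_eqI;
         simp add: gs icls_IC isum_IC iprod_IC IC_distrib IC_distrib2 IC_assoc isum_ac)
  qed (rule one)
  fix x y z assume x: "x \<in> carrier ?R" and y: "y \<in> carrier ?R" and z: "z \<in> carrier ?R"
  then show "(x \<oplus>\<^bsub>?R\<^esub> y) \<otimes>\<^bsub>?R\<^esub> z = x \<otimes>\<^bsub>?R\<^esub> z \<oplus>\<^bsub>?R\<^esub> y \<otimes>\<^bsub>?R\<^esub> z"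
      by (elim burnside_carrierE) (simp add: burnside_add burnside_mult gs, rule class_eqI;
         simp add: gs icls_IC isum_IC iprod_IC IC_distrib IC_distrib2 isum_ac)
qed

lemma fixed_sum: "H \<subseteq> carrier G \<Longrightarrow> gset_fixed H (gset_sum A B) = gset_fixed H A <+> gset_fixed H B"
  by (auto simp: gset_fixed_def gset_sum_def)

lemma fixed_prod: "H \<subseteq> carrier G \<Longrightarrow> gset_fixed H (gset_prod A B) = gset_fixed H A \<times> gset_fixed H B"
  by (auto simp: gset_fixed_def gset_prod_def)

lemma finite_fixed: "fin_gset G A \<Longrightarrow> finite (gset_fixed H A)"
  by (simp add: fin_gset_def gset_fixed_def)

lemma card_fixed_iso:
  assumes "H \<subseteq> carrier G" "fin_gset G A" "gset_iso G A B"
  shows "card (gset_fixed H A) = card (gset_fixed H B)"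
proof -
  obtain f f' where f: "\<And>x. x \<in> fst A \<Longrightarrow> f x \<in> fst B"  "\<And>x. x \<in> fst A \<Longrightarrow> f' (f x) = x"
    "\<And>x. x \<in> fst B \<Longrightarrow> f' x \<in> fst A" "\<And>x. x \<in> fst B \<Longrightarrow> f (f' x) = x"
    "\<And>g x. g \<in> carrier G \<Longrightarrow> x \<in> fst A \<Longrightarrow> f (snd A g x) = snd B g (f x)"
    using gset_isoE2[OF assms(3)] by blast
  have 1: "f x \<in> gset_fixed H B" if "x \<in> gset_fixed H A" for x
    using that f(1) f(5)[symmetric] assms(1) by (auto simp: gset_fixed_def subset_iff)
  have 2: "f' x \<in> gset_fixed H A" if x: "x \<in> gset_fixed H B" for x
  proof -
    have "snd A h (f' x) = f' x" if "h \<in> H" for h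
    proof -
      have "f (snd A h (f' x)) = f (f' x)" using that x f assms(1) by (simp add: gset_fixed_def subset_iff)
      moreover have "snd A h (f' x) \<in> fst A" using that x f(3) assms(1) fin_gsetD(3)[OF assms(2)]
        by (simp add: gset_fixed_def subset_iff)
      ultimately show ?thesis using f(2)[of "snd A h (f' x)"] f(2)[of "f' x"] f(3)[of x] x
        by (simp add: gset_fixed_def)
    qed
    then show ?thesis using x f(3) by (simp add: gset_fixed_def)
  qed
  have "bij_betw f (gset_fixed H A) (gset_fixed H B)"
    by (rule bij_betw_byWitness[where f' = f'])
      (use 1 2 f(2,4) in \<open>auto simp: gset_fixed_def\<close>)
  then show ?thesis by (rule bij_betw_same_card)
qed

lemma burnside_mark_class:
  assumes "H \<subseteq> carrier G" "fin_gset G X" "fin_gset G Y"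
  shows "burnside_mark H (gset_class G X Y) = int (card (gset_fixed H X)) - int (card (gset_fixed H Y))"
proof -
  have *: "int (card (gset_fixed H A)) - int (card (gset_fixed H B)) = int (card (gset_fixed H X)) - int (card (gset_fixed H Y))"
    if ab: "(A, B) \<in> gset_class G X Y" for A B
  proof -
    obtain Z :: "('a, nat) gset" where Z: "fin_gset G A" "fin_gset G B" "fin_gset G Z"
      "gset_iso G (gset_sum (gset_sum X B) Z) (gset_sum (gset_sum A Y) Z)"
      using ab by (auto simp: gset_class_def)
    have "card (gset_fixed H (gset_sum (gset_sum X B) Z)) = card (gset_fixed H (gset_sum (gset_sum A Y) Z))"
      by (rule card_fixed_iso[OF assms(1) _ Z(4)]) (simp add: gs assms Z)
    then show ?thesis
      by (simp add: fixed_sum[OF assms(1)] card_Plus finite_fixed[OF Z(1)] finite_fixed[OF Z(2)] finite_fixed[OF Z(3)]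
        finite_fixed[OF assms(2)] finite_fixed[OF assms(3)])
  qed
  obtain A B where ab: "(A, B) \<in> gset_class G X Y" using gset_class_nonempty assms(2,3) by blast
  have "(\<lambda>(A, B). int (card (gset_fixed H A)) - int (card (gset_fixed H B))) ` gset_class G X Y =
      {int (card (gset_fixed H X)) - int (card (gset_fixed H Y))}"
    by (rule trans[OF image_cong[OF refl] image_constant[OF ab]]) (use * in auto)
  then show ?thesis by (simp add: burnside_mark_def)
qed

lemma mark_hom:
  assumes "H \<subseteq> carrier G" "group G"
  shows "burnside_mark H \<in> ring_hom (burnside_ring G) \<Z>"
proof (rule ring_hom_memI)
  have [simp]: "finite (gset_fixed H A)" if "fin_gset G A" for A :: "('a, 'x) gset" using finite_fixed that .
  let ?R = "burnside_ring G"
  fix x y assume x: "x \<in> carrier ?R" and y: "y \<in> carrier ?R"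
  show "burnside_mark H x \<in> carrier \<Z>" by simp
  show "burnside_mark H (x \<otimes>\<^bsub>?R\<^esub> y) = burnside_mark H x \<otimes>\<^bsub>\<Z>\<^esub> burnside_mark H y"
    using x y by (elim burnside_carrierE) (simp add:  burnside_mult burnside_mark_class[OF assms(1)] gs fixed_sum[OF assms(1)]
       fixed_prod[OF assms(1)] card_Plus finite_fixed card_cartesian_product algebra_simps)
  show "burnside_mark H (x \<oplus>\<^bsub>?R\<^esub> y) = burnside_mark H x \<oplus>\<^bsub>\<Z>\<^esub> burnside_mark H y"
    using x y by (elim burnside_carrierE) (simp add:  burnside_add burnside_mark_class[OF assms(1)] gs fixed_sum[OF assms(1)]
       card_Plus finite_fixed algebra_simps)
next
  show "burnside_mark H \<one>\<^bsub>burnside_ring G\<^esub> = \<one>\<^bsub>\<Z>\<^esub>"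
    using assms by (simp add:  burnside_one burnside_mark_class gs)
      (simp add: gset_fixed_def gset_point_def gset_empty_def)
qed

lemma gset_iso_res: "gset_iso G A B \<Longrightarrow> H \<subseteq> carrier G \<Longrightarrow> gset_iso (G\<lparr>carrier := H\<rparr>) A B"
  unfolding gset_iso_def by (simp add: subset_iff) blast

lemma burnside_res_class:
  assumes "subgroup H G" "fin_gset G X" "fin_gset G Y"
  shows "burnside_res G H (gset_class G X Y) = gset_class (G\<lparr>carrier := H\<rparr>) X Y"
proof -
  note r = fin_gset_res[OF _ assms(1)]
  have *: "gset_class (G\<lparr>carrier := H\<rparr>) A B = gset_class (G\<lparr>carrier := H\<rparr>) X Y"
    if ab: "(A, B) \<in> gset_class G X Y" for A B
  proof -
    obtain Z :: "('a, nat) gset" where Z: "fin_gset G A" "fin_gset G B" "fin_gset G Z"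
      "gset_iso G (gset_sum (gset_sum X B) Z) (gset_sum (gset_sum A Y) Z)"
      using ab by (auto simp: gset_class_def)
    then have "(A, B) \<in> gset_class (G\<lparr>carrier := H\<rparr>) X Y"
      using r gset_iso_res[OF _ subgroup.subset[OF assms(1)]] unfolding gset_class_def by blast
    then show ?thesis using gset_class_memD(4)[OF r[OF assms(2)] r[OF assms(3)]] by blast
  qed
  obtain A B where ab: "(A, B) \<in> gset_class G X Y" using gset_class_nonempty assms(2,3) by blast
  show ?thesis unfolding burnside_res_def using * by (auto intro!: UN_constant_on[OF ab])
qed

lemma res_hom:
  assumes "subgroup H G" "group G"
  shows "burnside_res G H \<in> ring_hom (burnside_ring G) (burnside_ring (G\<lparr>carrier := H\<rparr>))"
proof (rule ring_hom_memI)
  note r = fin_gset_res[OF _ assms(1)]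
  let ?R = "burnside_ring G" let ?S = "burnside_ring (G\<lparr>carrier := H\<rparr>)"
  fix x y assume x: "x \<in> carrier ?R" and y: "y \<in> carrier ?R"
  show "burnside_res G H x \<in> carrier ?S" using x
    by (elim burnside_carrierE) (simp add: burnside_res_class[OF assms(1)] gset_class_carrier r)
  show "burnside_res G H (x \<otimes>\<^bsub>?R\<^esub> y) = burnside_res G H x \<otimes>\<^bsub>?S\<^esub> burnside_res G H y"
    using x y by (elim burnside_carrierE) (simp add: burnside_mult burnside_res_class[OF assms(1)] gs r)
  show "burnside_res G H (x \<oplus>\<^bsub>?R\<^esub> y) = burnside_res G H x \<oplus>\<^bsub>?S\<^esub> burnside_res G H y"
    using x y by (elim burnside_carrierE) (simp add: burnside_add burnside_res_class[OF assms(1)] gs r)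
next
  show "burnside_res G H \<one>\<^bsub>burnside_ring G\<^esub> = \<one>\<^bsub>burnside_ring (G\<lparr>carrier := H\<rparr>)\<^esub>"
    using assms by (simp add: burnside_one burnside_res_class gs)
qed

lemma fusion_subring:
  assumes "group S" "\<And>P. P \<in> Ob F \<Longrightarrow> P \<subseteq> carrier S"
  shows "subring (burnside_fusion S F) (burnside_ring S)"
proof -
  interpret cring "burnside_ring S" using assms(1) by (rule cring_burnside)
  let ?R = "burnside_ring S"
  note m = mark_hom[OF assms(2,1)]
  have mm: "burnside_mark P (x \<otimes>\<^bsub>?R\<^esub> y) = burnside_mark P x * burnside_mark P y"
     "burnside_mark P (x \<oplus>\<^bsub>?R\<^esub> y) = burnside_mark P x + burnside_mark P y"
    if "P \<in> Ob F" "x \<in> carrier ?R" "y \<in> carrier ?R" for P x y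
    using ring_hom_mult[OF m[OF that(1)] that(2,3)] ring_hom_add[OF m[OF that(1)] that(2,3)]
    by (simp_all add: )
  have m1: "burnside_mark P \<one>\<^bsub>?R\<^esub> = 1" if "P \<in> Ob F" for P
    using ring_hom_one[OF m[OF that]] by simp
  have m0: "burnside_mark P \<zero>\<^bsub>?R\<^esub> = 0" if "P \<in> Ob F" for P
    using mm(2)[OF that zero_closed zero_closed] by simp
  have mi: "burnside_mark P (\<ominus>\<^bsub>?R\<^esub> x) = - burnside_mark P x" if "P \<in> Ob F" "x \<in> carrier ?R" for P x
    using mm(2)[OF that(1,2) a_inv_closed[OF that(2)]] m0[OF that(1)] that(2) by (simp add: r_neg)
  show ?thesis
    by (rule subringI) (auto simp: burnside_fusion_def mm m1 mi)
qed

lemma fusion_iso_iff: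
  assumes "group G" "subgroup S G" "P \<in> Ob (fusion_system G S)" "Q \<in> Ob (fusion_system G S)"
  shows "fusion_iso (fusion_system G S) P Q \<longleftrightarrow>
    (\<exists>g\<in>carrier G. Q = (\<lambda>x. g \<otimes>\<^bsub>G\<^esub> x \<otimes>\<^bsub>G\<^esub> inv\<^bsub>G\<^esub> g) ` P)"
proof
  have PS: "P \<subseteq> S" "Q \<subseteq> S" using assms(3,4) subgroup.subset by (force simp: fusion_system_def)+
  then have PG: "P \<subseteq> carrier G" "Q \<subseteq> carrier G" using subgroup.subset[OF assms(2)] by auto
  {
    assume "fusion_iso (fusion_system G S) P Q"
    then obtain \<phi> \<psi> where *: "\<phi> \<in> Hom (fusion_system G S) P Q" "\<psi> \<in> Hom (fusion_system G S) Q P"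
      "compose Q \<phi> \<psi> = restrict id Q" by (auto simp: fusion_iso_def)
    then obtain g where g: "g \<in> carrier G" "\<phi> = restrict (\<lambda>x. g \<otimes>\<^bsub>G\<^esub> x \<otimes>\<^bsub>G\<^esub> inv\<^bsub>G\<^esub> g) P"
       "\<forall>x\<in>P. g \<otimes>\<^bsub>G\<^esub> x \<otimes>\<^bsub>G\<^esub> inv\<^bsub>G\<^esub> g \<in> Q" by (auto simp: fusion_system_def)
    have "y \<in> (\<lambda>x. g \<otimes>\<^bsub>G\<^esub> x \<otimes>\<^bsub>G\<^esub> inv\<^bsub>G\<^esub> g) ` P" if "y \<in> Q" for y
    proof -
      have "\<psi> y \<in> P" using *(2) that by (auto simp: fusion_system_def)
      moreover have "\<phi> (\<psi> y) = y" using fun_cong[OF *(3), of y] that by (simp add: compose_def)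
      ultimately show ?thesis using g(2) by (simp add: image_iff) metis
    qed
    then show "\<exists>g\<in>carrier G. Q = (\<lambda>x. g \<otimes>\<^bsub>G\<^esub> x \<otimes>\<^bsub>G\<^esub> inv\<^bsub>G\<^esub> g) ` P" using g by blast
  }
  assume "\<exists>g\<in>carrier G. Q = (\<lambda>x. g \<otimes>\<^bsub>G\<^esub> x \<otimes>\<^bsub>G\<^esub> inv\<^bsub>G\<^esub> g) ` P"
  then obtain g where g: "g \<in> carrier G" "Q = (\<lambda>x. g \<otimes>\<^bsub>G\<^esub> x \<otimes>\<^bsub>G\<^esub> inv\<^bsub>G\<^esub> g) ` P" by blast
  interpret group G by fact
  let ?i = "inv\<^bsub>G\<^esub> g"
  have c: "?i \<otimes>\<^bsub>G\<^esub> (g \<otimes>\<^bsub>G\<^esub> x \<otimes>\<^bsub>G\<^esub> ?i) \<otimes>\<^bsub>G\<^esub> inv\<^bsub>G\<^esub> ?i = x" if "x \<in> P" for x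
    using g(1) subsetD[OF PG(1) that] by (simp add: m_assoc inv_solve_left')
  let ?f = "restrict (\<lambda>x. g \<otimes>\<^bsub>G\<^esub> x \<otimes>\<^bsub>G\<^esub> inv\<^bsub>G\<^esub> g) P"
  let ?h = "restrict (\<lambda>x. ?i \<otimes>\<^bsub>G\<^esub> x \<otimes>\<^bsub>G\<^esub> inv\<^bsub>G\<^esub> ?i) Q"
  have "?f \<in> Hom (fusion_system G S) P Q" using g by (auto simp: fusion_system_def)
  moreover have "?h \<in> Hom (fusion_system G S) Q P"
    using g c by (auto simp: fusion_system_def intro!: exI[of _ ?i])
  moreover have "compose P ?h ?f = restrict id P" using g c by (auto simp: compose_def fun_eq_iff)
  moreover have "compose Q ?f ?h = restrict id Q" using g c by (auto simp: compose_def fun_eq_iff)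
  ultimately show "fusion_iso (fusion_system G S) P Q" unfolding fusion_iso_def by blast
qed

end

theory Submission
  imports Defs "HOL-Algebra.Left_Coset"
begin

text \<open>
  Given \<open>a \<in> B(\<F>)\<close>, let \<open>f(H)\<close> be the mark of \<open>a\<close> at a Sylow \<open>p\<close>-subgroup of \<open>H\<close>, conjugated
  into \<open>S\<close>. By \<open>\<F>\<close>-stability \<open>f\<close> is a well-defined function on the conjugacy classes of subgroups
  of \<open>G\<close>. It consists of the marks of an element of \<open>B(G)\<close>, which then restricts to \<open>a\<close> because
  marks are injective on \<open>B(S)\<close>.

  Whether a function \<open>f\<close> comes from \<open>B(G)\<close> is decided one prime \<open>q\<close> at a time, by the
  congruences \<open>\<Sum>\<^sub>t\<^sub>\<in>\<^sub>Q f(\<langle>t, H\<rangle>) \<equiv> 0\<close> modulo \<open>|Q|\<close> for the \<open>q\<close>-subgroups \<open>Q\<close> normalizing \<open>H\<close>. They hold for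
  marks by orbit counting on \<open>X\<^sup>H\<close>. Conversely, if \<open>f\<close> vanishes on the proper overgroups of \<open>H\<close>, they
  make \<open>f(H)\<close> divisible by \<open>|N(H) : H|\<close>, the mark of \<open>G/H\<close> at \<open>H\<close>, so that multiples of the
  transitive sets \<open>G/H\<close> can be split off by descending induction. For the \<open>f\<close> above the case
  \<open>q \<noteq> p\<close> is trivial, and the case \<open>q = p\<close> reduces to a congruence for \<open>a\<close> inside \<open>S\<close>.
\<close>

section \<open>Conjugates and products of subgroups\<close>

definition conj_set :: "('g, 'm) monoid_scheme \<Rightarrow> 'g \<Rightarrow> 'g set \<Rightarrow> 'g set" where
  "conj_set G g H = (\<lambda>x. g \<otimes>\<^bsub>G\<^esub> x \<otimes>\<^bsub>G\<^esub> inv\<^bsub>G\<^esub> g) ` H"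

context group
begin

lemma inv_cancel [simp]:
  "g \<in> carrier G \<Longrightarrow> x \<in> carrier G \<Longrightarrow> inv g \<otimes> (g \<otimes> x) = x"
  "g \<in> carrier G \<Longrightarrow> x \<in> carrier G \<Longrightarrow> g \<otimes> (inv g \<otimes> x) = x"
  by (simp_all flip: m_assoc)

lemma conj_set_mono: "H \<subseteq> K \<Longrightarrow> conj_set G g H \<subseteq> conj_set G g K"
  by (auto simp: conj_set_def)

lemma conj_set_carrier: "g \<in> carrier G \<Longrightarrow> H \<subseteq> carrier G \<Longrightarrow> conj_set G g H \<subseteq> carrier G"
  by (auto simp: conj_set_def)

lemma conj_set_conj_set:
  assumes "g \<in> carrier G" "h \<in> carrier G" "H \<subseteq> carrier G"
  shows "conj_set G g (conj_set G h H) = conj_set G (g \<otimes> h) H"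
proof -
  have "g \<otimes> (h \<otimes> x \<otimes> inv h) \<otimes> inv g = g \<otimes> h \<otimes> x \<otimes> inv (g \<otimes> h)" if "x \<in> H" for x
    using assms that by (auto simp: m_assoc inv_mult_group subset_iff)
  then show ?thesis by (simp add: conj_set_def image_image)
qed

lemma conj_set_one: "H \<subseteq> carrier G \<Longrightarrow> conj_set G \<one> H = H"
  by (force simp: conj_set_def subset_iff image_iff)

lemma conj_set_inv:
  "g \<in> carrier G \<Longrightarrow> H \<subseteq> carrier G \<Longrightarrow> conj_set G (inv g) (conj_set G g H) = H"
  "g \<in> carrier G \<Longrightarrow> H \<subseteq> carrier G \<Longrightarrow> conj_set G g (conj_set G (inv g) H) = H"
  by (simp_all add: conj_set_conj_set conj_set_one)

lemma conj_set_subset_iff: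
  "g \<in> carrier G \<Longrightarrow> H \<subseteq> carrier G \<Longrightarrow> K \<subseteq> carrier G \<Longrightarrow>
   conj_set G g H \<subseteq> K \<longleftrightarrow> H \<subseteq> conj_set G (inv g) K"
  using conj_set_mono[of "conj_set G g H" K "inv g"] conj_set_mono[of H "conj_set G (inv g) K" g]
  by (auto simp: conj_set_inv)

lemma inj_on_conj: "g \<in> carrier G \<Longrightarrow> H \<subseteq> carrier G \<Longrightarrow> inj_on (\<lambda>x. g \<otimes> x \<otimes> inv g) H"
  by (rule inj_onI) (auto simp: subset_iff)

lemma card_conj_set: "g \<in> carrier G \<Longrightarrow> H \<subseteq> carrier G \<Longrightarrow> card (conj_set G g H) = card H"
  unfolding conj_set_def by (rule card_image) (rule inj_on_conj)

lemma conj_mult: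
  "g \<in> carrier G \<Longrightarrow> x \<in> carrier G \<Longrightarrow> y \<in> carrier G \<Longrightarrow>
   g \<otimes> (x \<otimes> y) \<otimes> inv g = (g \<otimes> x \<otimes> inv g) \<otimes> (g \<otimes> y \<otimes> inv g)"
  by (simp add: m_assoc)

lemma conj_inv: "g \<in> carrier G \<Longrightarrow> x \<in> carrier G \<Longrightarrow> inv (g \<otimes> x \<otimes> inv g) = g \<otimes> inv x \<otimes> inv g"
  by (simp add: m_assoc inv_mult_group)

lemma subgroup_conj_set:
  assumes "g \<in> carrier G" "subgroup H G"
  shows "subgroup (conj_set G g H) G"
proof (rule subgroupI)
  note H = subgroup.subset[OF assms(2)]
  show "conj_set G g H \<subseteq> carrier G" using assms(1) H by (rule conj_set_carrier)
  show "conj_set G g H \<noteq> {}" using subgroup.one_closed[OF assms(2)] by (auto simp: conj_set_def)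
  show "inv a \<in> conj_set G g H" if "a \<in> conj_set G g H" for a
    using that assms H subgroup.m_inv_closed[OF assms(2)]
    by (auto simp: conj_set_def conj_inv subset_iff)
  show "a \<otimes> b \<in> conj_set G g H" if "a \<in> conj_set G g H" "b \<in> conj_set G g H" for a b
    using that assms H subgroup.m_closed[OF assms(2)]
    by (auto simp: conj_set_def subset_iff conj_mult[symmetric])
qed

text \<open>A conjugate of a subgroup is a subgroup, so the conjugate of \<open>generate G A\<close>
  contains the group generated by the conjugate of \<open>A\<close>. The same inclusion for
  \<open>inv g\<close> is the converse.\<close>

lemma conj_set_generate:
  assumes g: "g \<in> carrier G" and A: "A \<subseteq> carrier G"
  shows "conj_set G g (generate G A) = generate G (conj_set G g A)"
proof
  have sub: "generate G (conj_set G h B) \<subseteq> conj_set G h (generate G B)"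
    if "h \<in> carrier G" "B \<subseteq> carrier G" for h B
    using that by (intro generate_subgroup_incl subgroup_conj_set conj_set_mono)
      (auto intro: generate.incl generate_is_subgroup)
  show "generate G (conj_set G g A) \<subseteq> conj_set G g (generate G A)" by (rule sub[OF g A])
  have "generate G A \<subseteq> conj_set G (inv g) (generate G (conj_set G g A))"
    using sub[of "inv g" "conj_set G g A"] g A by (simp add: conj_set_carrier conj_set_inv)
  then show "conj_set G g (generate G A) \<subseteq> generate G (conj_set G g A)"
    by (simp add: conj_set_subset_iff[OF g generate_incl[OF A] generate_incl[OF conj_set_carrier[OF g A]]])
qed

text \<open>Each fibre of the multiplication map from \<open>M \<times> H\<close> onto
  \<open>M <#> H\<close> is parametrized by \<open>M \<inter> H\<close>: the factorizations of
  \<open>m \<otimes> h\<close> are the pairs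
  \<open>(m \<otimes> k, inv k \<otimes> h)\<close>.\<close>

lemma card_set_mult:
  assumes "subgroup M G" "subgroup H G" "finite M" "finite H"
  shows "card (M <#> H) * card (M \<inter> H) = card M * card H"
proof -
  note M = subgroup.mem_carrier[OF assms(1)] and H = subgroup.mem_carrier[OF assms(2)]
  let ?f = "\<lambda>(m, h). m \<otimes> h"
  have fib: "card {z \<in> M \<times> H. ?f z = y} = card (M \<inter> H)" if y: "y \<in> M <#> H" for y
  proof -
    obtain m h where mh: "m \<in> M" "h \<in> H" "y = m \<otimes> h" using y by (auto simp: set_mult_def)
    have key: "inv m \<otimes> a = h \<otimes> inv b" if z: "a \<in> M" "b \<in> H" "y = a \<otimes> b" for a b
    proof -
      note c = M[OF z(1)] H[OF z(2)] M[OF mh(1)] H[OF mh(2)]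
      have "a \<otimes> b \<otimes> inv b = m \<otimes> h \<otimes> inv b" using z(3) mh(3) by simp
      then have "a = m \<otimes> (h \<otimes> inv b)" using c by (simp add: m_assoc)
      then show ?thesis using c by simp
    qed
    have 1: "inv m \<otimes> a \<in> M \<inter> H" "inv (inv m \<otimes> a) \<otimes> h = b"
      if z: "a \<in> M" "b \<in> H" "y = a \<otimes> b" for a b
    proof -
      show "inv m \<otimes> a \<in> M \<inter> H"
      proof
        show "inv m \<otimes> a \<in> M"
          using z(1,2) mh(1,2) subgroup.m_closed[OF assms(1)] subgroup.m_inv_closed[OF assms(1)] by blast
        show "inv m \<otimes> a \<in> H" unfolding key[OF z]
          using z(1,2) mh(1,2) subgroup.m_closed[OF assms(2)] subgroup.m_inv_closed[OF assms(2)] by blast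
      qed
      show "inv (inv m \<otimes> a) \<otimes> h = b"
        unfolding key[OF z] using H[OF z(2)] H[OF mh(2)] by (simp add: inv_mult_group m_assoc)
    qed
    have 2: "m \<otimes> k \<in> M" "inv k \<otimes> h \<in> H" "m \<otimes> k \<otimes> (inv k \<otimes> h) = y" if "k \<in> M \<inter> H" for k
    proof -
      have k: "k \<in> carrier G" "m \<in> carrier G" "h \<in> carrier G" using that mh(1,2) M H by blast+
      show "m \<otimes> k \<in> M" "inv k \<otimes> h \<in> H"
        using that mh(1,2) subgroup.m_closed[OF assms(1)] subgroup.m_closed[OF assms(2)]
          subgroup.m_inv_closed[OF assms(2)] by blast+
      show "m \<otimes> k \<otimes> (inv k \<otimes> h) = y" using k mh(3) by (simp add: m_assoc)
    qed
    have "bij_betw (\<lambda>k. (m \<otimes> k, inv k \<otimes> h)) (M \<inter> H) {z \<in> M \<times> H. ?f z = y}"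
    proof (rule bij_betw_byWitness[where f' = "\<lambda>(a, b). inv m \<otimes> a"])
      show "\<forall>k\<in>M \<inter> H. (\<lambda>(a, b). inv m \<otimes> a) (m \<otimes> k, inv k \<otimes> h) = k"
        using mh(1) M by simp
      show "\<forall>z\<in>{z \<in> M \<times> H. ?f z = y}.
          (m \<otimes> (\<lambda>(a, b). inv m \<otimes> a) z, inv ((\<lambda>(a, b). inv m \<otimes> a) z) \<otimes> h) = z"
      proof clarify
        fix a b assume z: "a \<in> M" "b \<in> H" "y = a \<otimes> b"
        have "a \<in> carrier G" "m \<in> carrier G" using z(1) mh(1) M by blast+
        then show "m \<otimes> (inv m \<otimes> a) = a \<and> inv (inv m \<otimes> a) \<otimes> h = b" using 1(2)[OF z] by simp
      qed
      show "(\<lambda>k. (m \<otimes> k, inv k \<otimes> h)) ` (M \<inter> H) \<subseteq> {z \<in> M \<times> H. ?f z = y}"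
        using 2 by auto
      show "(\<lambda>(a, b). inv m \<otimes> a) ` {z \<in> M \<times> H. ?f z = y} \<subseteq> M \<inter> H"
      proof clarify
        fix a b assume z: "a \<in> M" "b \<in> H" "y = a \<otimes> b"
        show "inv m \<otimes> a \<in> M \<inter> H" by (rule 1(1)[OF z])
      qed
    qed
    from bij_betw_same_card[OF this] show ?thesis by simp
  qed
  have img: "?f ` (M \<times> H) = M <#> H" by (auto simp: set_mult_def)
  have "card M * card H = (\<Sum>z\<in>M \<times> H. 1)" by (simp add: card_cartesian_product)
  also have "\<dots> = (\<Sum>y\<in>M <#> H. \<Sum>z\<in>{z \<in> M \<times> H. ?f z = y}. 1)"
    unfolding img[symmetric] by (rule sum.image_gen) (simp add: assms)
  also have "\<dots> = (\<Sum>y\<in>M <#> H. card (M \<inter> H))"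
    by (intro sum.cong refl) (simp only: fib card_eq_sum[symmetric])
  finally show ?thesis by simp
qed

lemma subgroup_set_mult:
  assumes "subgroup M G" "subgroup H G"
    and norm: "\<And>m h. m \<in> M \<Longrightarrow> h \<in> H \<Longrightarrow> m \<otimes> h \<otimes> inv m \<in> H"
  shows "subgroup (M <#> H) G"
proof (rule subgroupI)
  note M = subgroup.mem_carrier[OF assms(1)] and H = subgroup.mem_carrier[OF assms(2)]
  note cl = subgroup.m_closed[OF assms(1)] subgroup.m_inv_closed[OF assms(1)]
    subgroup.m_closed[OF assms(2)] subgroup.m_inv_closed[OF assms(2)]
  show "M <#> H \<subseteq> carrier G" using M H by (auto simp: set_mult_def)
  show "M <#> H \<noteq> {}"
    using subgroup.one_closed[OF assms(1)] subgroup.one_closed[OF assms(2)]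
    by (auto simp: set_mult_def)
  show "inv a \<in> M <#> H" if ab: "a \<in> M <#> H" for a
  proof -
    obtain m h where a: "m \<in> M" "h \<in> H" "a = m \<otimes> h" using ab by (auto simp: set_mult_def)
    then have "inv a = inv m \<otimes> (m \<otimes> inv h \<otimes> inv m)"
      using M H by (simp add: inv_mult_group m_assoc)
    moreover have "m \<otimes> inv h \<otimes> inv m \<in> H" using norm cl a by blast
    ultimately show ?thesis using cl(2)[OF a(1)] by (auto simp: set_mult_def)
  qed
  show "a \<otimes> b \<in> M <#> H" if ab: "a \<in> M <#> H" "b \<in> M <#> H" for a b
  proof -
    obtain m h where a: "m \<in> M" "h \<in> H" "a = m \<otimes> h" using ab by (auto simp: set_mult_def)
    obtain n k where b: "n \<in> M" "k \<in> H" "b = n \<otimes> k" using ab by (auto simp: set_mult_def)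
    \<comment> \<open>Moving \<open>h\<close> past \<open>n\<close> replaces it by its conjugate
      under \<open>inv n\<close>, which stays in \<open>H\<close>.\<close>
    have "a \<otimes> b = (m \<otimes> n) \<otimes> ((inv n \<otimes> h \<otimes> inv (inv n)) \<otimes> k)"
      using a b M H by (simp add: m_assoc)
    moreover have "inv n \<otimes> h \<otimes> inv (inv n) \<in> H" using norm[of "inv n" h] a b cl by simp
    ultimately show ?thesis using cl(1)[OF a(1) b(1)] cl(3)[OF _ b(2)] by (auto simp: set_mult_def)
  qed
qed

lemma conj_set_of_set_mult:
  assumes Q: "subgroup Q G" and H: "subgroup H G" and norm: "\<And>t. t \<in> Q \<Longrightarrow> conj_set G t H \<subseteq> H"
    and t: "t \<in> Q <#> H"
  shows "conj_set G t H \<subseteq> H"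
proof -
  note Hc = subgroup.subset[OF H]
  obtain q h where *: "q \<in> Q" "h \<in> H" "t = q \<otimes> h" using t by (auto simp: set_mult_def)
  have c: "q \<in> carrier G" "h \<in> carrier G" using * Hc subgroup.mem_carrier[OF Q] by auto
  have "conj_set G h H \<subseteq> H"
    using *(2) Hc subgroup.m_closed[OF H] subgroup.m_inv_closed[OF H] by (auto simp: conj_set_def)
  then have "conj_set G q (conj_set G h H) \<subseteq> H" using norm[OF *(1)] conj_set_mono by blast
  then show ?thesis using c Hc *(3) by (simp add: conj_set_conj_set)
qed

lemma card_subgroup_dvd:
  assumes "subgroup H G" "subgroup K G" "H \<subseteq> K"
  shows "card H dvd card K"
proof -
  have "subgroup H (G\<lparr>carrier := K\<rparr>)" using assms by (simp add: subgroup_incl)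
  then have "card (rcosets\<^bsub>G\<lparr>carrier := K\<rparr>\<^esub> H) * card H = card K"
    using group.lagrange[OF subgroup_imp_group[OF assms(2)]] by (simp add: order_def)
  then show ?thesis by (metis dvd_triv_right)
qed

end

section \<open>Fixed points of conjugate and generated subgroups\<close>

text \<open>The action of \<open>g\<close> maps the fixed points of \<open>H\<close> bijectively
  onto those of its conjugate; \<open>inv g\<close> acts as the inverse map.\<close>

lemma card_fixed_conj:
  fixes G (structure)
  assumes X: "fin_gset G X" and g: "g \<in> carrier G" and H: "H \<subseteq> carrier G"
  shows "card (gset_fixed (conj_set G g H) X) = card (gset_fixed H X)"
proof -
  interpret group G using X by (rule fin_gsetD)
  note D = fin_gsetD[OF X]
  have act: "snd X k x \<in> gset_fixed (conj_set G k K) X"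
    if k: "k \<in> carrier G" and K: "K \<subseteq> carrier G" and x: "x \<in> gset_fixed K X" for k K x
  proof -
    have "snd X (k \<otimes> h \<otimes> inv k) (snd X k x) = snd X k x" if "h \<in> K" for h
    proof -
      have "snd X (k \<otimes> h \<otimes> inv k) (snd X k x) = snd X (k \<otimes> h) x"
        using D(6)[of "k \<otimes> h \<otimes> inv k" k x] k K that x by (auto simp: gset_fixed_def m_assoc subset_iff)
      also have "\<dots> = snd X k x" using D(6)[of k h x] k K that x by (auto simp: gset_fixed_def)
      finally show ?thesis .
    qed
    then show ?thesis using D(3) k x by (auto simp: gset_fixed_def conj_set_def)
  qed
  have inverse: "snd X (inv k) (snd X k x) = x" if "k \<in> carrier G" "x \<in> fst X" for k x
    using D(5,6) that by (metis inv_closed l_inv)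
  have "bij_betw (snd X g) (gset_fixed H X) (gset_fixed (conj_set G g H) X)"
  proof (rule bij_betw_byWitness[where f' = "snd X (inv g)"])
    show "snd X g ` gset_fixed H X \<subseteq> gset_fixed (conj_set G g H) X" using act[OF g H] by blast
    show "snd X (inv g) ` gset_fixed (conj_set G g H) X \<subseteq> gset_fixed H X"
      using act[OF inv_closed[OF g] conj_set_carrier[OF g H]] by (auto simp: conj_set_inv[OF g H])
    show "\<forall>x\<in>gset_fixed H X. snd X (inv g) (snd X g x) = x"
      using inverse[OF g] by (simp add: gset_fixed_def)
    show "\<forall>x\<in>gset_fixed (conj_set G g H) X. snd X g (snd X (inv g) x) = x"
      using inverse[OF inv_closed[OF g]] g by (simp add: gset_fixed_def)
  qed
  from bij_betw_same_card[OF this] show ?thesis by simp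
qed

text \<open>A point fixed by \<open>A\<close> has a stabilizer containing \<open>A\<close>, hence
  the subgroup generated by \<open>A\<close>. This turns the fixed point counts of the orbit
  counting argument into marks at generated subgroups.\<close>

lemma fixed_generate:
  fixes G (structure)
  assumes X: "fin_gset G X" and A: "A \<subseteq> carrier G"
  shows "gset_fixed (generate G A) X = gset_fixed A X"
proof
  interpret group G using X by (rule fin_gsetD)
  interpret group_action G "fst X" "snd X" using X by (simp add: fin_gset_def)
  show "gset_fixed (generate G A) X \<subseteq> gset_fixed A X"
    by (auto simp: gset_fixed_def intro: generate.incl)
  show "gset_fixed A X \<subseteq> gset_fixed (generate G A) X"
  proof
    fix x assume x: "x \<in> gset_fixed A X"
    then have "generate G A \<subseteq> stabilizer G (snd X) x"
      using A by (intro generate_subgroup_incl stabilizer_subgroup) (auto simp: gset_fixed_def stabilizer_def)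
    then show "x \<in> gset_fixed (generate G A) X" using x by (auto simp: gset_fixed_def stabilizer_def)
  qed
qed

section \<open>Finite \<open>G\<close>-sets are determined by their marks\<close>

definition sub_gset :: "'a set \<Rightarrow> ('g, 'a) gset \<Rightarrow> ('g, 'a) gset" where
  "sub_gset U X = (U, \<lambda>g. restrict (snd X g) U)"

lemma fin_sub_gset:
  assumes X: "fin_gset G X" and U: "U \<subseteq> fst X"
    and inv: "\<And>g x. g \<in> carrier G \<Longrightarrow> x \<in> U \<Longrightarrow> snd X g x \<in> U"
  shows "fin_gset G (sub_gset U X)"
  unfolding sub_gset_def
  by (rule fin_gsetI) (use fin_gsetD[OF X] U inv in \<open>auto simp: finite_subset subset_iff\<close>)

text \<open>If \<open>g\<close> moved a point into \<open>U\<close>, then applying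
  \<open>inv g\<close> would show that the point was in \<open>U\<close> already.\<close>

lemma compl_invariant:
  fixes G (structure)
  assumes X: "fin_gset G X" and U: "U \<subseteq> fst X"
    and inv: "\<And>g x. g \<in> carrier G \<Longrightarrow> x \<in> U \<Longrightarrow> snd X g x \<in> U"
    and g: "g \<in> carrier G" and x: "x \<in> fst X - U"
  shows "snd X g x \<in> fst X - U"
proof -
  interpret group G using X by (rule fin_gsetD)
  note D = fin_gsetD[OF X]
  have "snd X (inv g) (snd X g x) = x" using D(5,6) g x by (metis DiffD1 inv_closed l_inv)
  then show ?thesis using inv[of "inv g" "snd X g x"] g x D(3) by auto
qed

lemma sub_gset_split:
  assumes U: "U \<subseteq> fst X"
    and inv: "\<And>g x. g \<in> carrier G \<Longrightarrow> x \<in> U \<Longrightarrow> snd X g x \<in> U"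
    and inv': "\<And>g x. g \<in> carrier G \<Longrightarrow> x \<in> fst X - U \<Longrightarrow> snd X g x \<in> fst X - U"
  shows "gset_iso G (gset_sum (sub_gset U X) (sub_gset (fst X - U) X)) X"
  by (rule gset_isoI2[where f = "case_sum id id" and f' = "\<lambda>x. if x \<in> U then Inl x else Inr x"])
    (use U inv inv' in \<open>auto simp: gset_sum_def sub_gset_def\<close>)

lemma act_eq_iff:
  fixes G (structure)
  assumes X: "fin_gset G X" and x: "x \<in> fst X" and g: "g \<in> carrier G" "h \<in> carrier G"
  shows "snd X g x = snd X h x \<longleftrightarrow> inv h \<otimes> g \<in> stabilizer G (snd X) x"
proof -
  interpret group G using X by (rule fin_gsetD)
  note D = fin_gsetD[OF X]
  have "snd X g x = snd X h x \<longleftrightarrow> snd X (inv h) (snd X g x) = snd X (inv h) (snd X h x)"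
  proof
    assume "snd X (inv h) (snd X g x) = snd X (inv h) (snd X h x)"
    then have "snd X h (snd X (inv h) (snd X g x)) = snd X h (snd X (inv h) (snd X h x))" by simp
    then show "snd X g x = snd X h x" using D(3,5) x g by (simp flip: D(6))
  qed simp
  then show ?thesis using D(5) x g by (simp add: stabilizer_def flip: D(6))
qed

text \<open>Both orbits are copies of the cosets of the common stabilizer; the isomorphism sends the
  translate of \<open>x\<close> by \<open>g\<close> to the translate of \<open>y\<close> by
  \<open>g\<close>.\<close>

lemma orbit_iso:
  fixes G (structure)
  assumes X: "fin_gset G X" and Y: "fin_gset G Y" and x: "x \<in> fst X" and y: "y \<in> fst Y"
    and stab: "stabilizer G (snd X) x = stabilizer G (snd Y) y"
  shows "gset_iso G (sub_gset (orbit G (snd X) x) X) (sub_gset (orbit G (snd Y) y) Y)"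
proof -
  interpret group G using X by (rule fin_gsetD)
  \<comment> \<open>Any group element carrying \<open>x\<close> to \<open>z\<close> may be chosen:
    as the stabilizers agree, two choices move \<open>y\<close> to the same point.\<close>
  define f where "f = (\<lambda>z. snd Y (SOME g. g \<in> carrier G \<and> snd X g x = z) y)"
  have eq: "snd X g x = snd X h x \<longleftrightarrow> snd Y g y = snd Y h y"
    if "g \<in> carrier G" "h \<in> carrier G" for g h
    using act_eq_iff[OF X x that] act_eq_iff[OF Y y that] stab by simp
  have f: "f (snd X g x) = snd Y g y" if g: "g \<in> carrier G" for g
  proof -
    have "(SOME h. h \<in> carrier G \<and> snd X h x = snd X g x) \<in> carrier G \<and>
        snd X (SOME h. h \<in> carrier G \<and> snd X h x = snd X g x) x = snd X g x"
      by (rule someI[of _ g]) (use g in simp)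
    then show ?thesis using eq g unfolding f_def by blast
  qed
  show ?thesis
  proof (rule gset_isoI[of f])
    have "inj_on f (orbit G (snd X) x)" by (rule inj_onI) (auto simp: orbit_def f eq)
    moreover have "f ` orbit G (snd X) x = orbit G (snd Y) y"
      by (auto simp: orbit_def f image_iff) (metis f)
    ultimately show "bij_betw f (fst (sub_gset (orbit G (snd X) x) X)) (fst (sub_gset (orbit G (snd Y) y) Y))"
      by (simp add: bij_betw_def sub_gset_def)
    fix g z assume g: "g \<in> carrier G" and "z \<in> fst (sub_gset (orbit G (snd X) x) X)"
    then obtain h where h: "h \<in> carrier G" "z = snd X h x" by (auto simp: sub_gset_def orbit_def)
    then have "snd X g z = snd X (g \<otimes> h) x" "snd Y g (snd Y h y) = snd Y (g \<otimes> h) y"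
      using g x y fin_gsetD(6)[OF X] fin_gsetD(6)[OF Y] by simp_all
    then show "f (snd (sub_gset (orbit G (snd X) x) X) g z)
        = snd (sub_gset (orbit G (snd Y) y) Y) g (f z)"
      using g h f[of h] f[of "g \<otimes> h"] by (auto simp: sub_gset_def orbit_def)
  qed
qed

lemma orbit_invariant:
  fixes G (structure)
  assumes X: "fin_gset G X" and x: "x \<in> fst X"
  shows "orbit G (snd X) x \<subseteq> fst X" "x \<in> orbit G (snd X) x"
    "\<And>g z. g \<in> carrier G \<Longrightarrow> z \<in> orbit G (snd X) x \<Longrightarrow> snd X g z \<in> orbit G (snd X) x"
proof -
  interpret group G using X by (rule fin_gsetD)
  note D = fin_gsetD[OF X]
  show "orbit G (snd X) x \<subseteq> fst X" using D(3) x by (auto simp: orbit_def)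
  show "x \<in> orbit G (snd X) x" using D(5)[OF x] by (force simp: orbit_def)
  show "snd X g z \<in> orbit G (snd X) x" if "g \<in> carrier G" "z \<in> orbit G (snd X) x" for g z
    using that x by (auto simp: orbit_def simp flip: D(6))
qed

text \<open>A point \<open>x\<close> of \<open>A\<close> whose stabilizer \<open>H\<close> is as large as possible is matched by a point of \<open>B\<close>
  with the same stabilizer, so that the orbits of both can be removed.\<close>

lemma gset_iso_of_marks:
  fixes G :: "('g, 'm) monoid_scheme" (structure)
    and A :: "('g, 'a) gset" and B :: "('g, 'b) gset"
  assumes "finite (carrier G)" "fin_gset G A" "fin_gset G B"
    "\<And>H. subgroup H G \<Longrightarrow> card (gset_fixed H A) = card (gset_fixed H B)"
  shows "gset_iso G A B"
  using assms(2-)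
proof (induction "card (fst A)" arbitrary: A B rule: less_induct)
  case less
  note A = less.prems(1) and B = less.prems(2) and marks = less.prems(3)
  interpret group G using A by (rule fin_gsetD)
  interpret A: group_action G "fst A" "snd A" using A by (simp add: fin_gset_def)
  interpret B: group_action G "fst B" "snd B" using B by (simp add: fin_gset_def)
  show ?case
  proof (cases "fst A = {}")
    case True
    \<comment> \<open>The mark at the trivial subgroup is the number of points.\<close>
    have "card (gset_fixed {\<one>} B) = 0"
      using marks[OF triv_subgroup] True by (simp add: gset_fixed_def)
    then have "fst B = {}"
      using fin_gsetD(2,5)[OF B] by (auto simp: gset_fixed_def)
    with True show ?thesis by (intro gset_isoI) (auto simp: bij_betw_def)
  next
    case False
    define m where "m = Max ((\<lambda>x. card (stabilizer G (snd A) x)) ` fst A)"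
    have fin: "finite (fst A)" using fin_gsetD(2)[OF A] .
    have "m \<in> (\<lambda>x. card (stabilizer G (snd A) x)) ` fst A"
      unfolding m_def using fin False by (intro Max_in) auto
    then obtain x where x: "x \<in> fst A" "card (stabilizer G (snd A) x) = m" by blast
    have max: "card (stabilizer G (snd A) z) \<le> m" if "z \<in> fst A" for z
      unfolding m_def using fin that by (intro Max_ge) auto
    let ?H = "stabilizer G (snd A) x"
    have "x \<in> gset_fixed ?H A" using x by (simp add: gset_fixed_def stabilizer_def)
    then have "gset_fixed ?H B \<noteq> {}"
      using marks[OF A.stabilizer_subgroup[OF x(1)]] finite_fixed[OF A]
      by (metis card.empty card_0_eq empty_iff)
    then obtain y where y: "y \<in> fst B" "\<And>h. h \<in> ?H \<Longrightarrow> snd B h y = y"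
      by (auto simp: gset_fixed_def)
    let ?K = "stabilizer G (snd B) y"
    have HK: "?H \<subseteq> ?K" using y(2) by (auto simp: stabilizer_def)
    have "y \<in> gset_fixed ?K B" using y by (simp add: gset_fixed_def stabilizer_def)
    \<comment> \<open>The argument now goes back from \<open>B\<close> to \<open>A\<close>: a point
      \<open>z\<close> of \<open>A\<close> fixed by \<open>?K\<close> has a stabilizer containing
      \<open>?K\<close>, and maximality of \<open>card ?H\<close> forces
      \<open>?H = ?K\<close>.\<close>
    then have "gset_fixed ?K A \<noteq> {}"
      using marks[OF B.stabilizer_subgroup[OF y(1)]] finite_fixed[OF B]
      by (metis card.empty card_0_eq empty_iff)
    then obtain z where z: "z \<in> fst A" "\<And>h. h \<in> ?K \<Longrightarrow> snd A h z = z"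
      by (auto simp: gset_fixed_def)
    have fs: "finite (stabilizer G (snd A) z)" "finite ?K"
      by (rule finite_subset[OF _ assms(1)], rule A.stabilizer_subset B.stabilizer_subset)+
    have "?K \<subseteq> stabilizer G (snd A) z" using z(2) by (auto simp: stabilizer_def)
    from card_mono[OF fs(1) this] have "card ?K \<le> card ?H" using max[OF z(1)] x(2) by simp
    then have stab: "?H = ?K" using card_seteq[OF fs(2) HK] by blast
    let ?O = "orbit G (snd A) x" and ?O' = "orbit G (snd B) y"
    note i = orbit_invariant[OF A x(1)] and i' = orbit_invariant[OF B y(1)]
    note c = compl_invariant[OF A i(1,3)] and c' = compl_invariant[OF B i'(1,3)]
    let ?A1 = "sub_gset ?O A" and ?A2 = "sub_gset (fst A - ?O) A"
    let ?B1 = "sub_gset ?O' B" and ?B2 = "sub_gset (fst B - ?O') B"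
    have f: "fin_gset G ?A1" "fin_gset G ?A2" "fin_gset G ?B1" "fin_gset G ?B2"
      using fin_sub_gset[OF A i(1,3)] fin_sub_gset[OF A Diff_subset c]
        fin_sub_gset[OF B i'(1,3)] fin_sub_gset[OF B Diff_subset c'] by blast+
    have sA: "gset_iso G (gset_sum ?A1 ?A2) A" by (rule sub_gset_split[OF i(1,3) c])
    have sB: "gset_iso G (gset_sum ?B1 ?B2) B" by (rule sub_gset_split[OF i'(1,3) c'])
    have o: "gset_iso G ?A1 ?B1" by (rule orbit_iso[OF A B x(1) y(1) stab])
    have "gset_iso G ?A2 ?B2"
    proof (rule less.hyps)
      have "fst A - ?O \<subset> fst A" using i(2) x(1) by blast
      then show "card (fst ?A2) < card (fst A)"
        using psubset_card_mono[OF fin] by (simp add: sub_gset_def)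
      fix H assume H: "subgroup H G"
      note Hc = subgroup.subset[OF H]
      \<comment> \<open>Marks are additive on disjoint unions, so removing isomorphic orbits from
        both sides keeps the marks equal.\<close>
      have "card (gset_fixed H ?A1) + card (gset_fixed H ?A2) = card (gset_fixed H A)"
        using card_fixed_iso[OF Hc fin_gset_sum[OF f(1,2)] sA] f
        by (simp add: fixed_sum[OF Hc] card_Plus finite_fixed)
      moreover have "card (gset_fixed H ?B1) + card (gset_fixed H ?B2) = card (gset_fixed H B)"
        using card_fixed_iso[OF Hc fin_gset_sum[OF f(3,4)] sB] f
        by (simp add: fixed_sum[OF Hc] card_Plus finite_fixed)
      ultimately show "card (gset_fixed H ?A2) = card (gset_fixed H ?B2)"
        using card_fixed_iso[OF Hc f(1) o] marks[OF H] by simp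
    qed (use f in auto)
    then have "gset_iso G (gset_sum ?A1 ?A2) (gset_sum ?B1 ?B2)" by (rule gset_sum_cong[OF o])
    from gset_iso_trans[OF gset_iso_trans[OF gset_iso_sym[OF fin_gset_sum[OF f(1,2)] sA] this] sB]
    show ?thesis .
  qed
qed

text \<open>For \<open>a = [A] - [B]\<close> and \<open>b = [C] - [D]\<close>, moving the negative
  parts across gives genuine sets \<open>A + D\<close> and \<open>C + B\<close> with equal marks,
  which are therefore isomorphic.\<close>

lemma burnside_eq_of_marks:
  assumes "finite (carrier G)" and a: "a \<in> carrier (burnside_ring G)" and b: "b \<in> carrier (burnside_ring G)"
    and marks: "\<And>H. subgroup H G \<Longrightarrow> burnside_mark H a = burnside_mark H b"
  shows "a = b"
proof -
  obtain A B :: "('a, nat) gset" where 1: "fin_gset G A" "fin_gset G B" "a = gset_class G A B"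
    using a by (rule burnside_carrierE)
  obtain C D :: "('a, nat) gset" where 2: "fin_gset G C" "fin_gset G D" "b = gset_class G C D"
    using b by (rule burnside_carrierE)
  have "gset_iso G (gset_sum A D) (gset_sum C B)"
  proof (rule gset_iso_of_marks[OF assms(1)])
    fix H assume H: "subgroup H G"
    note Hc = subgroup.subset[OF H]
    show "card (gset_fixed H (gset_sum A D)) = card (gset_fixed H (gset_sum C B))"
      using marks[OF H] 1 2 by (simp add: burnside_mark_class[OF Hc] fixed_sum[OF Hc] card_Plus finite_fixed)
  qed (use 1 2 in \<open>simp_all add: fin_gset_sum\<close>)
  then show ?thesis unfolding 1(3) 2(3)
    using 1(1,2) 2(1,2) by (intro class_eqI) (simp_all add: icls_eqI fin_gset_sum flip: icls_sum)
qed

section \<open>Burnside congruences and transitive \<open>G\<close>-sets\<close>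

text \<open>As \<open>Q\<close> normalizes \<open>P\<close>, it acts on the fixed points of
  \<open>P\<close>. By the Cauchy-Frobenius formula the sum is \<open>card Q\<close> times the
  number of orbits of this action.\<close>

lemma card_dvd_sum_fixed:
  fixes G (structure)
  assumes fin: "finite (carrier G)" and X: "fin_gset G X" and Q: "subgroup Q G"
    and P: "P \<subseteq> carrier G" and norm: "\<And>t. t \<in> Q \<Longrightarrow> conj_set G t P \<subseteq> P"
  shows "card Q dvd (\<Sum>t\<in>Q. card (gset_fixed (insert t P) X))"
proof -
  interpret group G using X by (rule fin_gsetD)
  note D = fin_gsetD[OF X]
  let ?Y = "sub_gset (gset_fixed P X) X" and ?Q = "G\<lparr>carrier := Q\<rparr>"
  have inv: "snd X t x \<in> gset_fixed P X" if t: "t \<in> Q" and x: "x \<in> gset_fixed P X" for t x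
  proof -
    have tc: "t \<in> carrier G" using Q t by (rule subgroup.mem_carrier)
    have "snd X h (snd X t x) = snd X t x" if h: "h \<in> P" for h
    proof -
      have hc: "h \<in> carrier G" using h P by blast
      have "inv t \<otimes> h \<otimes> inv (inv t) \<in> P"
        using norm[OF subgroup.m_inv_closed[OF Q t]] h by (auto simp: conj_set_def)
      then have p: "inv t \<otimes> h \<otimes> t \<in> P" using tc by simp
      have "h \<otimes> t = t \<otimes> (inv t \<otimes> h \<otimes> t)" using tc hc by (simp add: m_assoc)
      then have "snd X h (snd X t x) = snd X t (snd X (inv t \<otimes> h \<otimes> t) x)"
        using tc hc x D(6)[of h t x] D(6)[of t "inv t \<otimes> h \<otimes> t" x] by (simp add: gset_fixed_def)
      then show ?thesis using p x by (simp add: gset_fixed_def)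
    qed
    then show ?thesis using D(3)[OF tc] x by (simp add: gset_fixed_def)
  qed
  have Y: "fin_gset ?Q ?Y"
    by (rule fin_sub_gset[OF fin_gset_res[OF X Q]]) (use inv in \<open>auto simp: gset_fixed_def[of P X]\<close>)
  then interpret Y: group_action ?Q "fst ?Y" "snd ?Y" by (simp add: fin_gset_def)
  have "finite Q" using finite_subset[OF subgroup.subset[OF Q] fin] .
  then have "card (orbits ?Q (fst ?Y) (snd ?Y)) * card Q = (\<Sum>t\<in>Q. card (invariants (fst ?Y) (snd ?Y) t))"
    using Y.burnside fin_gsetD(2)[OF Y] by (simp add: order_def)
  moreover have "invariants (fst ?Y) (snd ?Y) t = gset_fixed (insert t P) X" for t
    by (auto simp: invariants_def sub_gset_def gset_fixed_def)
  ultimately have eq: "card (orbits ?Q (fst ?Y) (snd ?Y)) * card Q = (\<Sum>t\<in>Q. card (gset_fixed (insert t P) X))"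
    by simp
  show ?thesis by (simp flip: eq)
qed

text \<open>All orbit lengths are powers of \<open>p\<close>. Some orbit has length prime to
  \<open>p\<close>, since the total is, and hence consists of one point.\<close>

lemma fixed_nonempty_of_p_group:
  fixes G (structure)
  assumes fin: "finite (carrier G)" and X: "fin_gset G X" and p: "prime p" and ord: "order G = p ^ n"
    and ndvd: "\<not> p dvd card (fst X)"
  shows "gset_fixed (carrier G) X \<noteq> {}"
proof -
  interpret group_action G "fst X" "snd X" using X by (simp add: fin_gset_def)
  have "(\<Sum>orb\<in>orbits G (fst X) (snd X). card orb) = card (fst X)"
    using disjoint_sum[OF fin_gsetD(2)[OF X], of "\<lambda>_. 1 :: nat"] by simp
  then obtain orb where orb: "orb \<in> orbits G (fst X) (snd X)" "\<not> p dvd card orb"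
    using ndvd by (metis dvd_sum)
  then obtain x where x: "x \<in> fst X" "orb = orbit G (snd X) x" by (auto simp: orbits_def)
  have "card orb dvd p ^ n"
    using orbit_stabilizer_theorem[OF x(1)] ord x(2) by (metis dvd_triv_left)
  then obtain i where "card orb = p ^ i" using divides_primepow_nat[OF p] by auto
  with orb(2) have "card orb = 1" by (cases i) auto
  then obtain y where "orb = {y}" by (auto simp: card_1_singleton_iff)
  then have "orbit G (snd X) x = {x}" using orbit_refl[OF x(1)] x(2) by auto
  then have "x \<in> gset_fixed (carrier G) X" using x(1) by (auto simp: gset_fixed_def orbit_def)
  then show ?thesis by blast
qed

section \<open>Transitive sets and their fixed cosets\<close>

definition coset_gset :: "('g, 'm) monoid_scheme \<Rightarrow> 'g set \<Rightarrow> ('g, 'g set) gset" where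
  "coset_gset G H = (lcosets\<^bsub>G\<^esub> H, \<lambda>g. \<lambda>C\<in>lcosets\<^bsub>G\<^esub> H. g <#\<^bsub>G\<^esub> C)"

context group
begin

lemma lcosetsE:
  assumes "C \<in> lcosets H" obtains a where "a \<in> carrier G" "C = a <# H"
  using assms by (auto simp: LCOSETS_def)

lemma lcosetsI: "a \<in> carrier G \<Longrightarrow> a <# H \<in> lcosets H"
  by (auto simp: LCOSETS_def)

lemma lcos_eq_iff:
  assumes "subgroup H G" "a \<in> carrier G" "b \<in> carrier G"
  shows "a <# H = b <# H \<longleftrightarrow> inv b \<otimes> a \<in> H"
proof
  assume "a <# H = b <# H"
  then have "a \<in> b <# H" using lcos_self[OF assms(2,1)] by simp
  then show "inv b \<otimes> a \<in> H" by (rule subgroup.lcos_module_imp[OF assms(1) is_group assms(3)])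
next
  assume "inv b \<otimes> a \<in> H"
  then have "a \<in> b <# H" using assms by (auto simp: l_coset_def intro!: bexI[of _ "inv b \<otimes> a"])
  then show "a <# H = b <# H" using l_repr_independence[OF _ assms(3,1)] by simp
qed

lemma fin_coset_gset:
  assumes "finite (carrier G)" "subgroup H G"
  shows "fin_gset G (coset_gset G H)"
  unfolding coset_gset_def
proof (rule fin_gsetI)
  note H = subgroup.subset[OF assms(2)]
  show "finite (lcosets H)" by (rule finite_subset[OF lcosets_subset_PowG[OF assms(2)]]) (simp add: assms(1))
  fix g C assume g: "g \<in> carrier G" and C: "C \<in> lcosets H"
  from C show "(\<lambda>C\<in>lcosets H. g <# C) C \<in> lcosets H"
    using g by (auto elim!: lcosetsE simp: lcos_m_assoc H lcosetsI)
next
  fix g h C assume g: "g \<in> carrier G" "h \<in> carrier G" and C: "C \<in> lcosets H"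
  note H = subgroup.subset[OF assms(2)]
  from C obtain a where "a \<in> carrier G" "C = a <# H" by (rule lcosetsE)
  then show "(\<lambda>C\<in>lcosets H. g \<otimes> h <# C) C
      = (\<lambda>C\<in>lcosets H. g <# C) ((\<lambda>C\<in>lcosets H. h <# C) C)"
    using g H by (simp add: lcosetsI lcos_m_assoc m_assoc)
next
  fix C assume C: "C \<in> lcosets H"
  then have "C \<subseteq> carrier G" using subgroup.lcosets_carrier[OF assms(2) is_group] by blast
  then show "(\<lambda>C\<in>lcosets H. \<one> <# C) C = C" using C by (simp add: lcos_mult_one)
qed (simp_all add: is_group)

lemma lcoset_fixed_iff:
  assumes H: "subgroup H G" and K: "K \<subseteq> carrier G" and a: "a \<in> carrier G"
  shows "a <# H \<in> gset_fixed K (coset_gset G H) \<longleftrightarrow> conj_set G (inv a) K \<subseteq> H"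
proof -
  have "k <# (a <# H) = a <# H \<longleftrightarrow> inv a \<otimes> k \<otimes> inv (inv a) \<in> H" if "k \<in> K" for k
    using that K a subgroup.subset[OF H] lcos_eq_iff[OF H, of "k \<otimes> a" a]
    by (auto simp: lcos_m_assoc m_assoc subset_iff)
  then show ?thesis
    using a by (auto simp: gset_fixed_def coset_gset_def lcosetsI conj_set_def)
qed

lemma coset_fixed_nonempty:
  assumes H: "subgroup H G" and K: "K \<subseteq> carrier G"
    and "gset_fixed K (coset_gset G H) \<noteq> {}"
  obtains g where "g \<in> carrier G" "conj_set G g K \<subseteq> H"
proof -
  obtain C where C: "C \<in> gset_fixed K (coset_gset G H)" using assms(3) by blast
  then have "C \<in> lcosets H" by (simp add: gset_fixed_def coset_gset_def)
  then obtain a where "a \<in> carrier G" "C = a <# H" by (rule lcosetsE)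
  then show ?thesis using C that[of "inv a"] lcoset_fixed_iff[OF H K] by auto
qed

text \<open>The number of cosets of \<open>P\<close> is prime to \<open>p\<close>, so the
  \<open>p\<close>-group \<open>Q\<close> fixes one of them; a fixed coset provides the conjugating
  element.\<close>

lemma p_subgroup_conj_into:
  assumes fin: "finite (carrier G)" and p: "prime p" and P: "subgroup P G"
    and ndvd: "\<not> p dvd order G div card P" and Q: "subgroup Q G" "card Q = p ^ n"
  obtains g where "g \<in> carrier G" "conj_set G g Q \<subseteq> P"
proof -
  have "card P > 0"
    by (rule subgroup.finite_imp_card_positive[OF P fin])
  then have "card (fst (coset_gset G P)) = order G div card P"
    by (simp add: coset_gset_def flip: l_lagrange[OF fin P])
  then have "gset_fixed (carrier (G\<lparr>carrier := Q\<rparr>)) (coset_gset G P) \<noteq> {}"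
    using fin_gset_res[OF fin_coset_gset[OF fin P] Q(1)] ndvd Q
      finite_subset[OF subgroup.subset[OF Q(1)] fin]
    by (intro fixed_nonempty_of_p_group[of _ _ p n]) (auto simp: order_def p)
  then show ?thesis
    using coset_fixed_nonempty[OF P subgroup.subset[OF Q(1)]] that by auto
qed

lemma mem_normalizer_iff:
  assumes "H \<subseteq> carrier G"
  shows "g \<in> normalizer G H \<longleftrightarrow> g \<in> carrier G \<and> conj_set G g H = H"
proof -
  have "g <# H #> inv g = conj_set G g H"
    by (auto simp: l_coset_def r_coset_def conj_set_def)
  then show ?thesis using assms by (auto simp: normalizer_def stabilizer_def)
qed

text \<open>A coset \<open>a <# H\<close> is fixed by \<open>H\<close> exactly when \<open>a\<close>
  normalizes \<open>H\<close>, so the fixed points are the cosets of \<open>H\<close> in its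
  normalizer.\<close>

lemma card_fixed_coset_self:
  assumes fin: "finite (carrier G)" and H: "subgroup H G"
  shows "card (gset_fixed H (coset_gset G H)) * card H = card (normalizer G H)"
proof -
  note Hc = subgroup.subset[OF H]
  let ?N = "normalizer G H"
  have N: "subgroup ?N G" by (rule normalizer_imp_subgroup[OF Hc])
  note mem = mem_normalizer_iff[OF Hc]
  have mem': "g \<in> ?N \<longleftrightarrow> conj_set G (inv g) H \<subseteq> H" if g: "g \<in> carrier G" for g
  proof -
    \<comment> \<open>Finiteness turns inclusion into equality, because conjugation preserves the
      order.\<close>
    have "conj_set G (inv g) H = H" if "conj_set G (inv g) H \<subseteq> H"
      using card_subset_eq[OF finite_subset[OF Hc fin] that] card_conj_set[OF _ Hc] g by simp
    moreover have "conj_set G (inv g) H = H \<longleftrightarrow> conj_set G g H = H"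
      using conj_set_inv[OF g Hc] by metis
    ultimately show ?thesis using g mem by blast
  qed
  have HN: "H \<subseteq> ?N"
  proof
    fix h assume h: "h \<in> H"
    then have "conj_set G (inv h) H \<subseteq> H"
      using H Hc subgroup.m_closed[OF H] subgroup.m_inv_closed[OF H] by (auto simp: conj_set_def)
    then show "h \<in> ?N" using mem' h Hc by blast
  qed
  have "gset_fixed H (coset_gset G H) = lcosets\<^bsub>G\<lparr>carrier := ?N\<rparr>\<^esub> H"
  proof
    show "gset_fixed H (coset_gset G H) \<subseteq> lcosets\<^bsub>G\<lparr>carrier := ?N\<rparr>\<^esub> H"
    proof
      fix C assume C: "C \<in> gset_fixed H (coset_gset G H)"
      then have "C \<in> lcosets H" by (simp add: gset_fixed_def coset_gset_def)
      then obtain a where a: "a \<in> carrier G" "C = a <# H" by (rule lcosetsE)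
      then have "a \<in> ?N" using C lcoset_fixed_iff[OF H Hc] mem' by blast
      then show "C \<in> lcosets\<^bsub>G\<lparr>carrier := ?N\<rparr>\<^esub> H"
        using a(2) by (auto simp: LCOSETS_def l_coset_def)
    qed
    show "lcosets\<^bsub>G\<lparr>carrier := ?N\<rparr>\<^esub> H \<subseteq> gset_fixed H (coset_gset G H)"
    proof
      fix C assume "C \<in> lcosets\<^bsub>G\<lparr>carrier := ?N\<rparr>\<^esub> H"
      then obtain a where a: "a \<in> ?N" "C = a <# H" by (auto simp: LCOSETS_def l_coset_def)
      then show "C \<in> gset_fixed H (coset_gset G H)"
        using lcoset_fixed_iff[OF H Hc] mem mem' by blast
    qed
  qed
  moreover have "finite ?N" using finite_subset[OF subgroup.subset[OF N] fin] .
  ultimately show ?thesis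
    using group.l_lagrange[OF subgroup_imp_group[OF N], of H] subgroup_incl[OF H N HN]
    by (simp add: order_def)
qed

end

section \<open>Marks of virtual \<open>G\<close>-sets\<close>

context
  fixes G (structure) and H
  assumes G: "group G" and H: "H \<subseteq> carrier G"
begin

lemma burnside_mark_add:
  "x \<in> carrier (burnside_ring G) \<Longrightarrow> y \<in> carrier (burnside_ring G) \<Longrightarrow>
   burnside_mark H (x \<oplus>\<^bsub>burnside_ring G\<^esub> y) = burnside_mark H x + burnside_mark H y"
  using ring_hom_add[OF mark_hom[OF H G]] by simp

lemma burnside_mark_zero: "burnside_mark H \<zero>\<^bsub>burnside_ring G\<^esub> = 0"
  by (simp add: burnside_zero burnside_mark_class[OF H] fin_gset_empty[OF G])

lemma burnside_mark_minus:
  assumes "x \<in> carrier (burnside_ring G)"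
  shows "burnside_mark H (\<ominus>\<^bsub>burnside_ring G\<^esub> x) = - burnside_mark H x"
proof -
  interpret R: cring "burnside_ring G" by (rule cring_burnside[OF G])
  have "burnside_mark H (x \<oplus>\<^bsub>burnside_ring G\<^esub> \<ominus>\<^bsub>burnside_ring G\<^esub> x) = 0"
    using assms by (simp add: R.r_neg burnside_mark_zero)
  then show ?thesis using assms by (simp add: burnside_mark_add)
qed

end

text \<open>Induction runs in both directions from 0, since the coefficient of a transitive set in a
  virtual set may be negative.\<close>

lemma burnside_int_multiple:
  fixes c :: int
  assumes G: "group G" and x: "x \<in> carrier (burnside_ring G)"
  shows "\<exists>y\<in>carrier (burnside_ring G). \<forall>H. H \<subseteq> carrier G \<longrightarrow> burnside_mark H y = c * burnside_mark H x"
proof -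
  interpret R: cring "burnside_ring G" by (rule cring_burnside[OF G])
  show ?thesis
  proof (induction c rule: int_induct[where k = 0])
    case base
    show ?case by (rule bexI[of _ "\<zero>\<^bsub>burnside_ring G\<^esub>"]) (simp_all add: burnside_mark_zero[OF G])
  next
    case (step1 i)
    then obtain y where "y \<in> carrier (burnside_ring G)"
      "\<And>H. H \<subseteq> carrier G \<Longrightarrow> burnside_mark H y = i * burnside_mark H x" by blast
    then show ?case using x
      by (intro bexI[of _ "y \<oplus>\<^bsub>burnside_ring G\<^esub> x"]) (simp_all add: burnside_mark_add[OF G] algebra_simps)
  next
    case (step2 i)
    then obtain y where "y \<in> carrier (burnside_ring G)"
      "\<And>H. H \<subseteq> carrier G \<Longrightarrow> burnside_mark H y = i * burnside_mark H x" by blast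
    then show ?case using x
      by (intro bexI[of _ "y \<oplus>\<^bsub>burnside_ring G\<^esub> (\<ominus>\<^bsub>burnside_ring G\<^esub> x)"])
        (simp_all add: burnside_mark_add[OF G] burnside_mark_minus[OF G] algebra_simps)
  qed
qed

section \<open>Realizing functions on subgroups as marks\<close>

context group
begin

text \<open>Sylow subgroups of \<open>H\<close> become subgroups of the ambient \<open>G\<close>, so
  that conjugation by elements outside \<open>H\<close> applies to them.\<close>

lemma sylow_subgroup_in_iff:
  assumes "subgroup H G"
  shows "sylow_subgroup (G\<lparr>carrier := H\<rparr>) p P \<longleftrightarrow>
    subgroup P G \<and> P \<subseteq> H \<and> card P = p ^ multiplicity p (card H)"
  using incl_subgroup[OF assms] subgroup_incl[OF _ assms] subgroup.subset
  by (fastforce simp: sylow_subgroup_def order_def)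

lemma sylow_subgroup_exists:
  assumes fin: "finite (carrier G)" and p: "prime p" and H: "subgroup H G"
  obtains P where "sylow_subgroup (G\<lparr>carrier := H\<rparr>) p P"
proof -
  have "finite H" using finite_subset[OF subgroup.subset[OF H] fin] .
  moreover have "order (G\<lparr>carrier := H\<rparr>) = p ^ multiplicity p (card H) * (card H div p ^ multiplicity p (card H))"
    by (simp add: order_def multiplicity_dvd)
  ultimately show ?thesis
    using sylow_thm[OF p subgroup_imp_group[OF H]] that by (auto simp: sylow_subgroup_def order_def)
qed

text \<open>It suffices that \<open>card ?N\<close> divides \<open>card H\<close> times
  \<open>f H\<close>, which is tested one prime at a time. For a Sylow \<open>q\<close>-subgroup
  \<open>Q\<close> of the normalizer, only the \<open>t\<close> in \<open>Q \<inter> H\<close>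
  contribute to the congruence, each with \<open>f H\<close>; any other \<open>t\<close> generates
  with \<open>H\<close> a proper overgroup.\<close>

lemma marks_coset_dvd:
  assumes fin: "finite (carrier G)" and H: "subgroup H G"
    and vanish: "\<And>L. subgroup L G \<Longrightarrow> H \<subset> L \<Longrightarrow> f L = (0 :: int)"
    and cong: "\<And>q Q n. prime q \<Longrightarrow> subgroup Q G \<Longrightarrow> card Q = q ^ n \<Longrightarrow>
      (\<And>t. t \<in> Q \<Longrightarrow> conj_set G t H \<subseteq> H) \<Longrightarrow>
      int (card Q) dvd (\<Sum>t\<in>Q. f (generate G (insert t H)))"
  shows "int (card (gset_fixed H (coset_gset G H))) dvd f H"
\<comment> \<open>Comparing multiplicities requires a nonzero value; for \<open>f H = 0\<close>
  divisibility is immediate.\<close>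
proof (cases "f H = 0")
  case False
  note Hc = subgroup.subset[OF H]
  let ?N = "normalizer G H"
  have N: "subgroup ?N G" by (rule normalizer_imp_subgroup[OF Hc])
  have norm: "conj_set G g H = H" if "g \<in> ?N" for g
    using that by (simp add: mem_normalizer_iff[OF Hc])
  have posH: "card H > 0" by (rule subgroup.finite_imp_card_positive[OF H fin])
  have posN: "card ?N > 0" by (rule subgroup.finite_imp_card_positive[OF N fin])
  have "card ?N dvd card H * nat \<bar>f H\<bar>"
  proof (rule multiplicity_le_imp_dvd)
    fix q :: nat assume q: "prime q"
    obtain Q where Q: "subgroup Q G" "Q \<subseteq> ?N" "card Q = q ^ multiplicity q (card ?N)"
      using sylow_subgroup_exists[OF fin q N] sylow_subgroup_in_iff[OF N] by metis
    note Qc = subgroup.subset[OF Q(1)]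
    have finQ: "finite Q" by (rule finite_subset[OF Qc fin])
    have "int (card Q) dvd (\<Sum>t\<in>Q. f (generate G (insert t H)))"
      using Q norm by (intro cong[OF q]) auto
    also have "(\<Sum>t\<in>Q. f (generate G (insert t H))) = (\<Sum>t\<in>Q. if t \<in> H then f H else 0)"
    proof (rule sum.cong[OF refl])
      fix t assume t: "t \<in> Q"
      have sub: "insert t H \<subseteq> carrier G" using t Qc Hc by blast
      show "f (generate G (insert t H)) = (if t \<in> H then f H else 0)"
      proof (cases "t \<in> H")
        case True
        then have "generate G (insert t H) = H"
          using generate_subgroup_incl[OF _ H] generate.incl[of _ H G] by (auto simp: insert_absorb)
        then show ?thesis using True by simp
      next
        case False
        moreover have "insert t H \<subseteq> generate G (insert t H)" by (auto intro: generate.incl)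
        ultimately show ?thesis using vanish[OF generate_is_subgroup[OF sub]] by auto
      qed
    qed
    also have "\<dots> = int (card (Q \<inter> H)) * f H"
      using finQ by (simp add: sum.If_cases)
    finally have "int (card Q) dvd \<bar>int (card (Q \<inter> H)) * f H\<bar>" by simp
    then have "card Q dvd card (Q \<inter> H) * nat \<bar>f H\<bar>"
      unfolding abs_mult by (simp flip: int_dvd_int_iff)
    moreover have "card (Q \<inter> H) dvd card H"
      by (rule card_subgroup_dvd[OF subgroups_Inter_pair[OF Q(1) H] H]) simp
    ultimately have "q ^ multiplicity q (card ?N) dvd card H * nat \<bar>f H\<bar>"
      using Q(3) by (metis dvd_trans mult_dvd_mono dvd_refl)
    then show "multiplicity q (card ?N) \<le> multiplicity q (card H * nat \<bar>f H\<bar>)"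
      using False posH q by (intro multiplicity_geI) auto
  qed (use posN posH False in auto)
  \<comment> \<open>The order of the normalizer is the mark of \<open>G/H\<close> at
    \<open>H\<close> times \<open>card H\<close>, so \<open>card H\<close> cancels.\<close>
  then have "card (gset_fixed H (coset_gset G H)) * card H dvd nat \<bar>f H\<bar> * card H"
    unfolding card_fixed_coset_self[OF fin H] by (simp only: mult.commute)
  then have "card (gset_fixed H (coset_gset G H)) dvd nat \<bar>f H\<bar>" using posH by simp
  then show ?thesis by (simp flip: int_dvd_int_iff)
qed simp

text \<open>The down-closed set \<open>U\<close> bounds the support of \<open>f\<close>; subtracting a multiple of the marks of
  \<open>G/H\<close>, for \<open>H\<close> of maximal order in \<open>U\<close>, removes the conjugacy class of \<open>H\<close> from it.\<close>

lemma burnside_of_marks_aux: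
  fixes f :: "'a set \<Rightarrow> int"
  assumes fin: "finite (carrier G)"
    and U: "\<And>K. K \<in> U \<Longrightarrow> subgroup K G"
      "\<And>J K g. K \<in> U \<Longrightarrow> subgroup J G \<Longrightarrow> g \<in> carrier G \<Longrightarrow> conj_set G g J \<subseteq> K \<Longrightarrow> J \<in> U"
    and supp: "\<And>K. subgroup K G \<Longrightarrow> f K \<noteq> 0 \<Longrightarrow> K \<in> U"
    and conj: "\<And>g K. g \<in> carrier G \<Longrightarrow> subgroup K G \<Longrightarrow> f (conj_set G g K) = f K"
    and cong: "\<And>q K Q n. prime q \<Longrightarrow> subgroup K G \<Longrightarrow> subgroup Q G \<Longrightarrow> card Q = q ^ n \<Longrightarrow>
      (\<And>t. t \<in> Q \<Longrightarrow> conj_set G t K \<subseteq> K) \<Longrightarrow>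
      int (card Q) dvd (\<Sum>t\<in>Q. f (generate G (insert t K)))"
  shows "\<exists>b\<in>carrier (burnside_ring G). \<forall>K. subgroup K G \<longrightarrow> burnside_mark K b = f K"
  using U supp conj cong
proof (induction "card U" arbitrary: U f rule: less_induct)
  case less
  note U = less.prems(1,2) and supp = less.prems(3) and conj = less.prems(4) and cong = less.prems(5)
  interpret R: cring "burnside_ring G" by (rule cring_burnside[OF is_group])
  have finU: "finite U"
  proof (rule finite_subset)
    show "U \<subseteq> Pow (carrier G)" using U(1) subgroup.subset by blast
  qed (simp add: fin)
  show ?case
  proof (cases "U = {}")
    case True
    then have "f K = 0" if "subgroup K G" for K using supp[OF that] by blast
    then show ?thesis
      by (intro bexI[of _ "\<zero>\<^bsub>burnside_ring G\<^esub>"]) (auto simp: burnside_mark_zero[OF is_group subgroup.subset])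
  next
    case False
    then have "Max (card ` U) \<in> card ` U" using finU by (intro Max_in) auto
    then obtain H where HU: "H \<in> U" and "card H = Max (card ` U)" by auto
    then have max: "card K \<le> card H" if "K \<in> U" for K using finU that by simp
    have H: "subgroup H G" using U(1) HU .
    note Hc = subgroup.subset[OF H]
    have finH: "finite K" if "subgroup K G" for K using finite_subset[OF subgroup.subset[OF that] fin] .
    let ?X = "coset_gset G H"
    have X: "fin_gset G ?X" by (rule fin_coset_gset[OF fin H])
    define m where "m = (\<lambda>K. int (card (gset_fixed K ?X)))"
    \<comment> \<open>A proper overgroup of \<open>H\<close> has larger order than any member of
      \<open>U\<close>, so it lies outside the support of \<open>f\<close>.\<close>
    have vanish: "f L = 0" if L: "subgroup L G" "H \<subset> L" for L
    proof (rule ccontr)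
      assume "f L \<noteq> 0"
      then have "card L \<le> card H" using supp[OF L(1)] max by blast
      then show False using psubset_card_mono[OF finH[OF L(1)] L(2)] by simp
    qed
    have "m H dvd f H" unfolding m_def
      by (rule marks_coset_dvd[where f = f, OF fin H vanish cong[OF _ H]])
    then obtain c where c: "f H = m H * c" by (auto elim: dvdE)
    define f' where "f' = (\<lambda>K. f K - c * m K)"
    have m_conj: "m (conj_set G g K) = m K" if "g \<in> carrier G" "subgroup K G" for g K
      unfolding m_def using card_fixed_conj[OF X that(1) subgroup.subset[OF that(2)]] by simp
    define U' where "U' = U - {K. \<exists>g\<in>carrier G. conj_set G g K = H}"
    have "\<exists>b\<in>carrier (burnside_ring G). \<forall>K. subgroup K G \<longrightarrow> burnside_mark K b = f' K"
    proof (rule less.hyps)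
      have "H \<notin> U'" using conj_set_one[OF Hc] by (auto simp: U'_def)
      then have "U' \<subset> U" using HU by (auto simp: U'_def)
      then show "card U' < card U" by (rule psubset_card_mono[OF finU])
    next
      show "subgroup K G" if "K \<in> U'" for K using that U(1) by (simp add: U'_def)
    next
      fix J K g assume K: "K \<in> U'" and J: "subgroup J G" and g: "g \<in> carrier G" "conj_set G g J \<subseteq> K"
      note Jc = subgroup.subset[OF J]
      have KU: "K \<in> U" "subgroup K G" using K U(1) by (auto simp: U'_def)
      \<comment> \<open>Down-closure survives the removal: if \<open>J\<close> were conjugate to
        \<open>H\<close>, then its conjugate inside \<open>K\<close> would have the maximal order
        and fill \<open>K\<close>, making \<open>K\<close> conjugate to \<open>H\<close>
        too.\<close>
      have "conj_set G h J \<noteq> H" if h: "h \<in> carrier G" for h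
      proof
        assume eq: "conj_set G h J = H"
        have "card H = card (conj_set G g J)"
          unfolding eq[symmetric] using card_conj_set[OF _ Jc] g(1) h by simp
        then have "conj_set G g J = K"
          using max[OF KU(1)] card_seteq[OF finH[OF KU(2)] g(2)] by simp
        moreover have "conj_set G (h \<otimes> inv g) (conj_set G g J) = H"
          using g(1) h Jc eq by (simp add: conj_set_conj_set m_assoc)
        ultimately have "conj_set G (h \<otimes> inv g) K = H" by simp
        then show False using K g h by (auto simp: U'_def)
      qed
      then show "J \<in> U'" using U(2)[OF KU(1) J g] by (auto simp: U'_def)
    next
      fix K assume K: "subgroup K G" "f' K \<noteq> 0"
      have "K \<in> U"
      proof (cases "f K = 0")
        case True
        \<comment> \<open>Where only the marks of \<open>G/H\<close> are nonzero, \<open>K\<close>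
          is subconjugate to \<open>H\<close> and hence in \<open>U\<close>.\<close>
        then have "gset_fixed K ?X \<noteq> {}" using K(2) by (auto simp: f'_def m_def)
        then obtain g where "g \<in> carrier G" "conj_set G g K \<subseteq> H"
          using coset_fixed_nonempty[OF H subgroup.subset[OF K(1)]] by blast
        then show ?thesis using U(2)[OF HU K(1)] by blast
      qed (use supp K in blast)
      \<comment> \<open>By the choice of \<open>c\<close>, the function \<open>f'\<close> vanishes
        at \<open>H\<close>, hence on its whole conjugacy class.\<close>
      moreover have "conj_set G g K \<noteq> H" if g: "g \<in> carrier G" for g
        using conj[OF g K(1)] m_conj[OF g K(1)] K(2) c by (auto simp: f'_def mult.commute)
      ultimately show "K \<in> U'" by (auto simp: U'_def)
    next
      show "f' (conj_set G g K) = f' K" if "g \<in> carrier G" "subgroup K G" for g K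
        using conj[OF that] m_conj[OF that] by (simp add: f'_def)
    next
      fix q K Q n assume *: "prime (q :: nat)" "subgroup K G" "subgroup Q G" "card Q = q ^ n"
        "\<And>t. t \<in> Q \<Longrightarrow> conj_set G t K \<subseteq> K"
      note Kc = subgroup.subset[OF *(2)] and Qc = subgroup.subset[OF *(3)]
      have "m (generate G (insert t K)) = int (card (gset_fixed (insert t K) ?X))" if "t \<in> Q" for t
        using fixed_generate[OF X, of "insert t K"] that Kc Qc by (auto simp: m_def)
      then have "(\<Sum>t\<in>Q. m (generate G (insert t K))) = int (\<Sum>t\<in>Q. card (gset_fixed (insert t K) ?X))"
        by simp
      then have "int (card Q) dvd (\<Sum>t\<in>Q. m (generate G (insert t K)))"
        using card_dvd_sum_fixed[OF fin X *(3) Kc *(5)] by (simp only: int_dvd_int_iff)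
      then show "int (card Q) dvd (\<Sum>t\<in>Q. f' (generate G (insert t K)))"
        using cong[OF *] by (simp add: f'_def sum_subtractf flip: sum_distrib_left)
    qed
    then obtain b where b: "b \<in> carrier (burnside_ring G)"
      "\<And>K. subgroup K G \<Longrightarrow> burnside_mark K b = f' K" by blast
    let ?x = "gset_class G ?X (gset_empty :: ('a, unit) gset)"
    note e = fin_gset_empty[OF is_group]
    obtain y where y: "y \<in> carrier (burnside_ring G)"
      "\<And>K. K \<subseteq> carrier G \<Longrightarrow> burnside_mark K y = c * burnside_mark K ?x"
      using burnside_int_multiple[OF is_group gset_class_carrier[OF X e]] by metis
    have "burnside_mark K (b \<oplus>\<^bsub>burnside_ring G\<^esub> y) = f K" if K: "subgroup K G" for K
    proof -
      note Kc = subgroup.subset[OF K]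
      have "burnside_mark K y = c * m K"
        unfolding y(2)[OF Kc] burnside_mark_class[OF Kc X e] m_def
        by (simp add: gset_empty_def) (simp add: gset_fixed_def)
      then show ?thesis
        by (simp add: burnside_mark_add[OF is_group Kc b(1) y(1)] b(2)[OF K] f'_def)
    qed
    then show ?thesis using b(1) y(1) by blast
  qed
qed

lemma burnside_of_marks:
  fixes f :: "'a set \<Rightarrow> int"
  assumes "finite (carrier G)"
    and "\<And>g K. g \<in> carrier G \<Longrightarrow> subgroup K G \<Longrightarrow> f (conj_set G g K) = f K"
    and "\<And>q K Q n. prime q \<Longrightarrow> subgroup K G \<Longrightarrow> subgroup Q G \<Longrightarrow> card Q = q ^ n \<Longrightarrow>
      (\<And>t. t \<in> Q \<Longrightarrow> conj_set G t K \<subseteq> K) \<Longrightarrow>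
      int (card Q) dvd (\<Sum>t\<in>Q. f (generate G (insert t K)))"
  obtains b where "b \<in> carrier (burnside_ring G)"
    "\<And>K. subgroup K G \<Longrightarrow> burnside_mark K b = f K"
  using burnside_of_marks_aux[of "{K. subgroup K G}" f] assms that by blast

end

section \<open>Sylow subgroups\<close>

context group
begin

lemma conj_set_consistent:
  "subgroup S G \<Longrightarrow> t \<in> S \<Longrightarrow> conj_set (G\<lparr>carrier := S\<rparr>) t P = conj_set G t P"
  by (simp add: conj_set_def)

text \<open>The preceding fixed coset argument is carried out inside the group \<open>H\<close>,
  where the index of \<open>P\<close> is prime to \<open>p\<close>. The conjugating element
  therefore lies in \<open>H\<close>.\<close>

lemma p_subgroup_conj_into_sylow:
  assumes fin: "finite (carrier G)" and p: "prime p" and H: "subgroup H G"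
    and P: "sylow_subgroup (G\<lparr>carrier := H\<rparr>) p P"
    and Q: "subgroup Q G" "Q \<subseteq> H" "card Q = p ^ n"
  obtains g where "g \<in> H" "conj_set G g Q \<subseteq> P"
proof -
  interpret H: group "G\<lparr>carrier := H\<rparr>" by (rule subgroup_imp_group[OF H])
  have finH: "finite H" by (rule finite_subset[OF subgroup.subset[OF H] fin])
  have "card H > 0" by (rule subgroup.finite_imp_card_positive[OF H fin])
  then have "\<not> p dvd card H div p ^ multiplicity p (card H)"
    using multiplicity_decompose[of "card H" p] prime_gt_1_nat[OF p] by simp
  then obtain g where "g \<in> H" "conj_set (G\<lparr>carrier := H\<rparr>) g Q \<subseteq> P"
    using H.p_subgroup_conj_into[OF _ p _ _ subgroup_incl[OF Q(1) H Q(2)] Q(3), of P] P finH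
    by (auto simp: sylow_subgroup_def order_def)
  then show ?thesis using that conj_set_consistent[OF H] by auto
qed

lemma sylow_subgroups_conj:
  assumes fin: "finite (carrier G)" and p: "prime p" and H: "subgroup H G"
    and P: "sylow_subgroup (G\<lparr>carrier := H\<rparr>) p P" and Q: "sylow_subgroup (G\<lparr>carrier := H\<rparr>) p Q"
  obtains g where "g \<in> carrier G" "conj_set G g Q = P"
proof -
  note P' = iffD1[OF sylow_subgroup_in_iff[OF H] P] and Q' = iffD1[OF sylow_subgroup_in_iff[OF H] Q]
  obtain g where g: "g \<in> H" "conj_set G g Q \<subseteq> P"
    using p_subgroup_conj_into_sylow[OF fin p H P] Q' by metis
  have gc: "g \<in> carrier G" using H g(1) by (rule subgroup.mem_carrier)
  have "finite P" using P' finite_subset[OF subgroup.subset fin] by blast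
  moreover have "card (conj_set G g Q) = card P"
    using card_conj_set[OF gc] subgroup.subset P' Q' by metis
  ultimately show ?thesis using card_subset_eq[OF _ g(2)] gc that by blast
qed

lemma sylow_subgroup_conj_set:
  assumes H: "subgroup H G" and P: "sylow_subgroup (G\<lparr>carrier := H\<rparr>) p P" and g: "g \<in> carrier G"
  shows "sylow_subgroup (G\<lparr>carrier := conj_set G g H\<rparr>) p (conj_set G g P)"
proof -
  note P' = iffD1[OF sylow_subgroup_in_iff[OF H] P]
  then show ?thesis
    using subgroup_conj_set[OF g] H card_conj_set[OF g subgroup.subset] conj_set_mono
    by (simp add: sylow_subgroup_in_iff)
qed

text \<open>Some \<open>g\<close> in \<open>H\<close> conjugates \<open>Q\<close> into a given Sylow
  subgroup; conjugating that subgroup back by \<open>inv g\<close> leaves \<open>H\<close>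
  unchanged.\<close>

lemma sylow_subgroup_containing:
  assumes fin: "finite (carrier G)" and p: "prime p" and H: "subgroup H G"
    and Q: "subgroup Q G" "Q \<subseteq> H" "card Q = p ^ n"
  obtains P where "sylow_subgroup (G\<lparr>carrier := H\<rparr>) p P" "Q \<subseteq> P"
proof -
  obtain P where P: "sylow_subgroup (G\<lparr>carrier := H\<rparr>) p P"
    using sylow_subgroup_exists[OF fin p H] .
  obtain g where g: "g \<in> H" "conj_set G g Q \<subseteq> P"
    using p_subgroup_conj_into_sylow[OF fin p H P Q] .
  note P' = iffD1[OF sylow_subgroup_in_iff[OF H] P] and Hc = subgroup.subset[OF H]
  have gc: "g \<in> carrier G" "inv g \<in> H" using g(1) H Hc subgroup.m_inv_closed by auto
  have "Q \<subseteq> conj_set G (inv g) P"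
    using g(2) P' conj_set_subset_iff[OF gc(1) subgroup.subset[OF Q(1)] subgroup.subset] by blast
  moreover have "conj_set G (inv g) H = H"
  proof (rule card_subset_eq[OF finite_subset[OF Hc fin]])
    show "conj_set G (inv g) H \<subseteq> H"
      using subgroup.m_closed[OF H] gc(2) g(1) Hc gc(1) by (auto simp: conj_set_def)
  qed (use card_conj_set[OF _ Hc] gc in simp)
  ultimately show ?thesis
    using sylow_subgroup_conj_set[OF H P, of "inv g"] gc(1) that by simp
qed

end

text \<open>The value at \<open>H\<close> is the mark of \<open>a\<close> at a Sylow \<open>p\<close>-subgroup of \<open>H\<close>, transported into \<open>S\<close>
  by conjugation.\<close>

definition sylow_mark ::
    "('g, 'm) monoid_scheme \<Rightarrow> nat \<Rightarrow> 'g set \<Rightarrow> 'g burnside \<Rightarrow> 'g set \<Rightarrow> int" where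
  "sylow_mark G p S a H = burnside_mark (SOME P. P \<subseteq> S \<and>
     (\<exists>g\<in>carrier G. \<exists>Q. sylow_subgroup (G\<lparr>carrier := H\<rparr>) p Q \<and> P = conj_set G g Q)) a"

section \<open>The function attached to a stable element and its congruences\<close>

locale fusion_element = group G for G (structure) +
  fixes p :: nat and S a
  assumes finite_G: "finite (carrier G)" and prime_p: "prime p" and sylow_S: "sylow_subgroup G p S"
    and a_fusion: "a \<in> burnside_fusion (G\<lparr>carrier := S\<rparr>) (fusion_system G S)"
begin

lemma S_subgroup: "subgroup S G"
  using sylow_S by (simp add: sylow_subgroup_def)

lemma a_carrier: "a \<in> carrier (burnside_ring (G\<lparr>carrier := S\<rparr>))"
  using a_fusion by (simp add: burnside_fusion_def)

text \<open>This is the stability condition with isomorphism in the fusion system spelled out as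
  conjugation in \<open>G\<close>.\<close>

lemma mark_conj_set:
  assumes P: "subgroup P G" "P \<subseteq> S" and g: "g \<in> carrier G" "conj_set G g P \<subseteq> S"
  shows "burnside_mark (conj_set G g P) a = burnside_mark P a"
proof -
  have ob: "P \<in> Ob (fusion_system G S)" "conj_set G g P \<in> Ob (fusion_system G S)"
    using subgroup_incl[OF P(1) S_subgroup P(2)]
      subgroup_incl[OF subgroup_conj_set[OF g(1) P(1)] S_subgroup g(2)]
    by (simp_all add: fusion_system_def)
  have "fusion_iso (fusion_system G S) P (conj_set G g P)"
    unfolding fusion_iso_iff[OF is_group S_subgroup ob] using g(1) by (auto simp: conj_set_def)
  then show ?thesis using a_fusion ob by (auto simp: burnside_fusion_def)
qed

lemma conj_into_S:
  assumes "subgroup Q G" "card Q = p ^ n"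
  obtains g where "g \<in> carrier G" "conj_set G g Q \<subseteq> S"
proof (rule p_subgroup_conj_into_sylow[OF finite_G prime_p subgroup_self])
  show "sylow_subgroup (G\<lparr>carrier := carrier G\<rparr>) p S" using sylow_S by simp
qed (use assms subgroup.subset that in auto)

text \<open>Independence of the choices: two Sylow subgroups of \<open>H\<close> are conjugate, so
  their transports into \<open>S\<close> are conjugate in \<open>G\<close>, and stability of
  \<open>a\<close> applies.\<close>

lemma sylow_mark_eq:
  assumes H: "subgroup H G" and P: "sylow_subgroup (G\<lparr>carrier := H\<rparr>) p P"
    and g: "g \<in> carrier G" "conj_set G g P \<subseteq> S"
  shows "sylow_mark G p S a H = burnside_mark (conj_set G g P) a"
proof -
  let ?R = "\<lambda>P. P \<subseteq> S \<and>
     (\<exists>g\<in>carrier G. \<exists>Q. sylow_subgroup (G\<lparr>carrier := H\<rparr>) p Q \<and> P = conj_set G g Q)"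
  have "?R (Eps ?R)" by (rule someI[of ?R "conj_set G g P"]) (use g P in blast)
  then obtain k Q where Q: "sylow_subgroup (G\<lparr>carrier := H\<rparr>) p Q"
    and k: "k \<in> carrier G" "Eps ?R = conj_set G k Q" "conj_set G k Q \<subseteq> S" by auto
  note P' = iffD1[OF sylow_subgroup_in_iff[OF H] P]
  have PG: "subgroup P G" and Pc: "P \<subseteq> carrier G" using P' subgroup.subset by blast+
  obtain h where h: "h \<in> carrier G" "conj_set G h P = Q"
    using sylow_subgroups_conj[OF finite_G prime_p H Q P] .
  \<comment> \<open>The conjugating element undoes \<open>g\<close>, then moves \<open>P\<close> to
    \<open>Q\<close> by \<open>h\<close>, then applies \<open>k\<close>.\<close>
  have eq: "conj_set G k Q = conj_set G (k \<otimes> h \<otimes> inv g) (conj_set G g P)"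
    using k(1) h g(1) Pc by (simp add: conj_set_conj_set m_assoc flip: h(2))
  have "burnside_mark (conj_set G k Q) a = burnside_mark (conj_set G g P) a"
    unfolding eq using g k h subgroup_conj_set[OF g(1) PG]
    by (intro mark_conj_set) (simp_all add: k(3)[unfolded eq])
  then show ?thesis unfolding sylow_mark_def k(2) .
qed

lemma sylow_mark_eqI:
  assumes "subgroup H G" "subgroup K G" "sylow_subgroup (G\<lparr>carrier := H\<rparr>) p P"
    "sylow_subgroup (G\<lparr>carrier := K\<rparr>) p P"
  shows "sylow_mark G p S a H = sylow_mark G p S a K"
proof -
  have "subgroup P G" "card P = p ^ multiplicity p (card H)"
    using assms(3) sylow_subgroup_in_iff[OF assms(1)] by blast+
  then obtain g where "g \<in> carrier G" "conj_set G g P \<subseteq> S" by (rule conj_into_S)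
  then show ?thesis using sylow_mark_eq assms by simp
qed

text \<open>A subgroup of \<open>S\<close> is a \<open>p\<close>-group, hence its own Sylow
  subgroup, and needs no transport. This is why the element realizing \<open>sylow_mark\<close>
  restricts to \<open>a\<close>.\<close>

lemma sylow_mark_self:
  assumes P: "subgroup P G" "P \<subseteq> S"
  shows "sylow_mark G p S a P = burnside_mark P a"
proof -
  have Pc: "P \<subseteq> carrier G" by (rule subgroup.subset[OF P(1)])
  have "card P dvd p ^ multiplicity p (order G)"
    using card_subgroup_dvd[OF P(1) S_subgroup P(2)] sylow_S by (simp add: sylow_subgroup_def)
  then obtain i where "card P = p ^ i" using divides_primepow_nat[OF prime_p] by auto
  then have "sylow_subgroup (G\<lparr>carrier := P\<rparr>) p P"
    using P prime_p by (simp add: sylow_subgroup_in_iff)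
  then show ?thesis
    using sylow_mark_eq[OF P(1) _ one_closed] P(2) conj_set_one[OF Pc] by simp
qed

text \<open>If \<open>h\<close> moves a Sylow subgroup \<open>P\<close> of \<open>H\<close> into
  \<open>S\<close>, then \<open>h \<otimes> inv g\<close> moves the conjugate of \<open>P\<close> by
  \<open>g\<close> to the same place.\<close>

lemma sylow_mark_conj_set:
  assumes g: "g \<in> carrier G" and H: "subgroup H G"
  shows "sylow_mark G p S a (conj_set G g H) = sylow_mark G p S a H"
proof -
  obtain P where P: "sylow_subgroup (G\<lparr>carrier := H\<rparr>) p P"
    using sylow_subgroup_exists[OF finite_G prime_p H] .
  note P' = iffD1[OF sylow_subgroup_in_iff[OF H] P]
  have Pc: "P \<subseteq> carrier G" using P' subgroup.subset by blast
  obtain h where h: "h \<in> carrier G" "conj_set G h P \<subseteq> S" using conj_into_S P' by metis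
  have eq: "conj_set G (h \<otimes> inv g) (conj_set G g P) = conj_set G h P"
    using g h Pc by (simp add: conj_set_conj_set m_assoc)
  have "sylow_mark G p S a (conj_set G g H) = burnside_mark (conj_set G (h \<otimes> inv g) (conj_set G g P)) a"
    by (rule sylow_mark_eq[OF subgroup_conj_set[OF g H] sylow_subgroup_conj_set[OF H P g]])
      (use g h in \<open>simp_all add: eq\<close>)
  then show ?thesis using sylow_mark_eq[OF H P h] eq by simp
qed

text \<open>Write \<open>a = [A] - [B]\<close> with \<open>S\<close>-sets \<open>A\<close> and
  \<open>B\<close>, and subtract the orbit counting congruences of the two.\<close>

lemma mark_congruence:
  assumes Q: "subgroup Q G" "Q \<subseteq> S" and P: "P \<subseteq> S" and norm: "\<And>t. t \<in> Q \<Longrightarrow> conj_set G t P \<subseteq> P"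
  shows "int (card Q) dvd (\<Sum>t\<in>Q. burnside_mark (generate G (insert t P)) a)"
proof -
  let ?S = "G\<lparr>carrier := S\<rparr>"
  obtain A B :: "('a, nat) gset" where AB: "fin_gset ?S A" "fin_gset ?S B" "a = gset_class ?S A B"
    using a_carrier by (rule burnside_carrierE)
  have finS: "finite S" by (rule finite_subset[OF subgroup.subset[OF S_subgroup] finite_G])
  have cong: "card Q dvd (\<Sum>t\<in>Q. card (gset_fixed (insert t P) X))"
    if "fin_gset ?S X" for X :: "('a, nat) gset"
    by (rule card_dvd_sum_fixed[OF _ that subgroup_incl[OF Q(1) S_subgroup Q(2)]])
      (use finS P norm conj_set_consistent[OF S_subgroup subsetD[OF Q(2)]] in simp_all)
  have "burnside_mark (generate G (insert t P)) a
      = int (card (gset_fixed (insert t P) A)) - int (card (gset_fixed (insert t P) B))"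
    if "t \<in> Q" for t
  proof -
    have sub: "insert t P \<subseteq> S" using that Q(2) P by blast
    note gen = generate_consistent[OF sub S_subgroup]
    show ?thesis
      unfolding AB(3)
      using burnside_mark_class[of "generate G (insert t P)" ?S, OF _ AB(1,2)]
        generate_subgroup_incl[OF sub S_subgroup]
        fixed_generate[OF AB(1), of "insert t P"] fixed_generate[OF AB(2), of "insert t P"] sub
      by (simp add: gen)
  qed
  then have "(\<Sum>t\<in>Q. burnside_mark (generate G (insert t P)) a)
      = int (\<Sum>t\<in>Q. card (gset_fixed (insert t P) A)) - int (\<Sum>t\<in>Q. card (gset_fixed (insert t P) B))"
    by (simp add: sum_subtractf)
  then show ?thesis
    using cong[OF AB(1)] cong[OF AB(2)] by (simp only: dvd_diff int_dvd_int_iff)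
qed

text \<open>A \<open>p'\<close>-group normalizing \<open>H\<close> does not affect the Sylow \<open>p\<close>-subgroups of \<open>H\<close>, so here all
  summands agree.\<close>

lemma sylow_mark_congruence_coprime:
  assumes q: "prime q" "q \<noteq> p" and H: "subgroup H G" and Q: "subgroup Q G" "card Q = q ^ n"
    and norm: "\<And>t. t \<in> Q \<Longrightarrow> conj_set G t H \<subseteq> H"
  shows "int (card Q) dvd (\<Sum>t\<in>Q. sylow_mark G p S a (generate G (insert t H)))"
proof -
  note Hc = subgroup.subset[OF H] and Qc = subgroup.subset[OF Q(1)]
  have fH: "finite H" "finite Q" using finite_subset[OF _ finite_G] Hc Qc by auto
  have posH: "card H > 0" by (rule subgroup.finite_imp_card_positive[OF H finite_G])
  let ?M = "Q <#> H"
  have M: "subgroup ?M G"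
    by (rule subgroup_set_mult[OF Q(1) H]) (use norm in \<open>auto simp: conj_set_def\<close>)
  \<comment> \<open>This bounds the \<open>p\<close>-part of every group between \<open>H\<close>
    and \<open>?M\<close> by that of \<open>H\<close>, as \<open>q\<close> differs from
    \<open>p\<close>.\<close>
  have cardM: "card ?M dvd q ^ n * card H"
    using card_set_mult[OF Q(1) H fH(2,1)] Q(2) by (metis dvd_triv_left)
  obtain P where P: "sylow_subgroup (G\<lparr>carrier := H\<rparr>) p P"
    using sylow_subgroup_exists[OF finite_G prime_p H] .
  note P' = iffD1[OF sylow_subgroup_in_iff[OF H] P]
  have "sylow_mark G p S a (generate G (insert t H)) = sylow_mark G p S a H" if t: "t \<in> Q" for t
  proof -
    let ?L = "generate G (insert t H)"
    have sub: "insert t H \<subseteq> carrier G" using t Qc Hc by blast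
    have L: "subgroup ?L G" by (rule generate_is_subgroup[OF sub])
    have HL: "H \<subseteq> ?L" by (auto intro: generate.incl)
    have "t \<otimes> \<one> \<in> ?M" using t subgroup.one_closed[OF H] by (auto simp: set_mult_def)
    moreover have "H \<subseteq> ?M" using subgroup.one_closed[OF Q(1)] Hc by (force simp: set_mult_def)
    ultimately have "insert t H \<subseteq> ?M" using t Qc by auto
    then have "card ?L dvd card ?M" by (intro card_subgroup_dvd[OF L M] generate_subgroup_incl M)
    then have "card ?L dvd q ^ n * card H" using cardM by (rule dvd_trans)
    then have "multiplicity p (card ?L) \<le> multiplicity p (q ^ n * card H)"
      using posH q(1) by (intro dvd_imp_multiplicity_le) (auto simp: prime_gt_0_nat)
    also have "\<dots> = multiplicity p (card H)"
      using posH q prime_p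
      by (simp add: prime_elem_multiplicity_mult_distrib prime_elem_multiplicity_power_distrib
          prime_multiplicity_other prime_gt_0_nat)
    finally have "multiplicity p (card ?L) = multiplicity p (card H)"
      using dvd_imp_multiplicity_le[OF card_subgroup_dvd[OF H L HL], of p]
        subgroup.finite_imp_card_positive[OF L finite_G] by simp
    then have "sylow_subgroup (G\<lparr>carrier := ?L\<rparr>) p P"
      using P' HL by (auto simp: sylow_subgroup_in_iff[OF L])
    then show ?thesis using sylow_mark_eqI[OF L H _ P] by simp
  qed
  then show ?thesis by simp
qed

text \<open>With \<open>T\<close> a Sylow \<open>p\<close>-subgroup of \<open>QH\<close> containing \<open>Q\<close> and \<open>P = T \<inter> H\<close>, the group generated by
  \<open>t \<in> Q\<close> and \<open>P\<close> is Sylow in the one generated by \<open>t\<close> and \<open>H\<close>. Conjugating \<open>T\<close> into \<open>S\<close>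
  turns the sum into one for the element \<open>a\<close> of \<open>B(S)\<close>.\<close>

lemma sylow_mark_congruence_p:
  assumes H: "subgroup H G" and Q: "subgroup Q G" "card Q = p ^ n"
    and norm: "\<And>t. t \<in> Q \<Longrightarrow> conj_set G t H \<subseteq> H"
  shows "int (card Q) dvd (\<Sum>t\<in>Q. sylow_mark G p S a (generate G (insert t H)))"
proof -
  note Hc = subgroup.subset[OF H] and Qc = subgroup.subset[OF Q(1)]
  have fin: "finite K" "card K > 0" if "subgroup K G" for K
    using finite_subset[OF subgroup.subset[OF that] finite_G]
      subgroup.finite_imp_card_positive[OF that finite_G] by auto
  have mult: "multiplicity p (x * y) = multiplicity p x + multiplicity p y"
    if "x > 0" "y > 0" for x y :: nat
    using that prime_p by (simp add: prime_elem_multiplicity_mult_distrib)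
  let ?M = "Q <#> H"
  have M: "subgroup ?M G"
    by (rule subgroup_set_mult[OF Q(1) H]) (use norm in \<open>auto simp: conj_set_def\<close>)
  have QM: "Q \<subseteq> ?M" using subgroup.one_closed[OF H] Qc by (force simp: set_mult_def)
  have HM: "H \<subseteq> ?M" using subgroup.one_closed[OF Q(1)] Hc by (force simp: set_mult_def)
  obtain T where sT: "sylow_subgroup (G\<lparr>carrier := ?M\<rparr>) p T" and QT: "Q \<subseteq> T"
    using sylow_subgroup_containing[OF finite_G prime_p M Q(1) QM Q(2)] .
  have T: "subgroup T G" "T \<subseteq> ?M" "card T = p ^ multiplicity p (card ?M)"
    using sT sylow_subgroup_in_iff[OF M] by blast+
  note Tc = subgroup.subset[OF T(1)]
  have normT: "conj_set G t H \<subseteq> H" if "t \<in> T" for t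
    using conj_set_of_set_mult[OF Q(1) H norm] that T(2) by blast
  define P where "P = T \<inter> H"
  have P: "subgroup P G" unfolding P_def by (rule subgroups_Inter_pair[OF T(1) H])
  note Pc = subgroup.subset[OF P]
  \<comment> \<open>\<open>P\<close> is Sylow in \<open>H\<close>: since \<open>T <#> H\<close> lies
    in \<open>?M\<close>, its \<open>p\<close>-part is at most \<open>card T\<close>. Comparing
    \<open>p\<close>-parts in the product formula for \<open>T <#> H\<close> gives one inequality,
    Lagrange the other.\<close>
  have multP: "multiplicity p (card P) = multiplicity p (card H)"
  proof -
    have TH: "subgroup (T <#> H) G"
      by (rule subgroup_set_mult[OF T(1) H]) (use normT in \<open>auto simp: conj_set_def\<close>)
    have "T <#> H \<subseteq> ?M"
      using T(2) HM subgroup.m_closed[OF M] by (auto simp: set_mult_def[of G T H])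
    then have "card (T <#> H) dvd card ?M" by (rule card_subgroup_dvd[OF TH M])
    then have "multiplicity p (card (T <#> H)) \<le> multiplicity p (card T)"
      using T(3) prime_p fin(2)[OF M] by (simp add: dvd_imp_multiplicity_le)
    moreover have "multiplicity p (card (T <#> H)) + multiplicity p (card P)
        = multiplicity p (card T) + multiplicity p (card H)"
      using card_set_mult[OF T(1) H fin(1)[OF T(1)] fin(1)[OF H]]
        mult[OF fin(2)[OF TH] fin(2)[OF P]] mult[OF fin(2)[OF T(1)] fin(2)[OF H]]
      by (simp add: P_def)
    moreover have "multiplicity p (card P) \<le> multiplicity p (card H)"
      using card_subgroup_dvd[OF P H] fin(2)[OF H] by (simp add: P_def dvd_imp_multiplicity_le)
    ultimately show ?thesis by simp
  qed
  have sylow: "sylow_subgroup (G\<lparr>carrier := generate G (insert t H)\<rparr>) p (generate G (insert t P))"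
    if t: "t \<in> Q" for t
  proof -
    let ?L = "generate G (insert t H)" and ?K = "generate G (insert t P)"
    have L: "subgroup ?L G" using t Qc Hc by (intro generate_is_subgroup) blast
    have K: "subgroup ?K G" using t Qc Pc by (intro generate_is_subgroup) blast
    have KT: "?K \<subseteq> T" using t QT by (intro generate_subgroup_incl T(1)) (auto simp: P_def)
    have KL: "?K \<subseteq> ?L" by (rule mono_generate) (auto simp: P_def)
    have HL: "H \<subseteq> ?L" and PK: "P \<subseteq> ?K" and tK: "t \<in> ?K" by (auto intro: generate.incl)
    have KH: "subgroup (?K <#> H) G"
      by (rule subgroup_set_mult[OF K H]) (use normT KT in \<open>auto simp: conj_set_def\<close>)
    \<comment> \<open>This factorization and \<open>?K \<inter> H = P\<close> feed the product
      formula. As \<open>P\<close> has the full \<open>p\<close>-part of \<open>H\<close>, the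
      \<open>p\<close>-parts of \<open>?L\<close> and \<open>?K\<close> agree, and \<open>?K\<close>
      is a \<open>p\<close>-group inside \<open>T\<close>.\<close>
    have "?L = ?K <#> H"
    proof
      have "t \<otimes> \<one> \<in> ?K <#> H" using tK subgroup.one_closed[OF H] by (auto simp: set_mult_def)
      moreover have "H \<subseteq> ?K <#> H"
        using subgroup.one_closed[OF K] Hc by (force simp: set_mult_def)
      ultimately have "insert t H \<subseteq> ?K <#> H" using t Qc by auto
      then show "?L \<subseteq> ?K <#> H" by (rule generate_subgroup_incl[OF _ KH])
      show "?K <#> H \<subseteq> ?L"
        using KL HL subgroup.m_closed[OF L] by (auto simp: set_mult_def)
    qed
    moreover have "?K \<inter> H = P" using PK KT by (auto simp: P_def)
    ultimately have "card ?L * card P = card ?K * card H"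
      using card_set_mult[OF K H fin(1)[OF K] fin(1)[OF H]] by simp
    then have "multiplicity p (card ?L) = multiplicity p (card ?K)"
      using mult[OF fin(2)[OF L] fin(2)[OF P]] mult[OF fin(2)[OF K] fin(2)[OF H]] multP by simp
    moreover obtain i where "card ?K = p ^ i"
      using card_subgroup_dvd[OF K T(1) KT] T(3) divides_primepow_nat[OF prime_p] by auto
    ultimately show ?thesis
      using K KL prime_p by (simp add: sylow_subgroup_in_iff[OF L])
  qed
  obtain g where g: "g \<in> carrier G" "conj_set G g T \<subseteq> S" using conj_into_S[OF T(1,3)] .
  let ?c = "\<lambda>x. g \<otimes> x \<otimes> inv g"
  have "sylow_mark G p S a (generate G (insert t H)) =
      burnside_mark (generate G (insert (?c t) (conj_set G g P))) a" if t: "t \<in> Q" for t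
  proof -
    have sub: "insert t P \<subseteq> T" using t QT by (auto simp: P_def)
    have "conj_set G g (generate G (insert t P)) \<subseteq> S"
      using conj_set_mono[OF generate_subgroup_incl[OF sub T(1)]] g(2) by blast
    moreover have "conj_set G g (generate G (insert t P)) = generate G (insert (?c t) (conj_set G g P))"
      using conj_set_generate[OF g(1) subset_trans[OF sub Tc]] by (simp add: conj_set_def)
    moreover have "subgroup (generate G (insert t H)) G"
      using t Qc Hc by (intro generate_is_subgroup) blast
    ultimately show ?thesis using sylow_mark_eq[OF _ sylow[OF t] g(1)] by simp
  qed
  then have "(\<Sum>t\<in>Q. sylow_mark G p S a (generate G (insert t H)))
      = (\<Sum>t\<in>Q. burnside_mark (generate G (insert (?c t) (conj_set G g P))) a)" by simp
  \<comment> \<open>Reindexing along conjugation by \<open>g\<close> makes this a sum over a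
    subgroup of \<open>S\<close>.\<close>
  also have "\<dots> = (\<Sum>t\<in>conj_set G g Q. burnside_mark (generate G (insert t (conj_set G g P))) a)"
    unfolding conj_set_def[of G g Q] by (simp add: sum.reindex[OF inj_on_conj[OF g(1) Qc]])
  finally have eq: "(\<Sum>t\<in>Q. sylow_mark G p S a (generate G (insert t H)))
      = (\<Sum>t\<in>conj_set G g Q. burnside_mark (generate G (insert t (conj_set G g P))) a)" .
  \<comment> \<open>Elements of \<open>Q\<close> normalize \<open>H\<close> by assumption and
    \<open>T\<close> because they lie in it, hence also the intersection.\<close>
  have normP: "conj_set G t P \<subseteq> P" if t: "t \<in> Q" for t
  proof -
    have "t \<in> T" using t QT by blast
    then have "conj_set G t T \<subseteq> T"
      using subgroup.m_closed[OF T(1)] subgroup.m_inv_closed[OF T(1)] by (auto simp: conj_set_def)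
    then show ?thesis using norm[OF t] by (auto simp: P_def conj_set_def)
  qed
  have "int (card (conj_set G g Q)) dvd
      (\<Sum>t\<in>conj_set G g Q. burnside_mark (generate G (insert t (conj_set G g P))) a)"
  proof (rule mark_congruence[OF subgroup_conj_set[OF g(1) Q(1)]])
    show "conj_set G g Q \<subseteq> S" using conj_set_mono[OF QT] g(2) by blast
    show "conj_set G g P \<subseteq> S" using conj_set_mono[of P T g] g(2) by (auto simp: P_def)
    fix t' assume "t' \<in> conj_set G g Q"
    then obtain t where t: "t \<in> Q" "t' = ?c t" by (auto simp: conj_set_def)
    have tc: "t \<in> carrier G" using t(1) Qc by blast
    have "conj_set G t' (conj_set G g P) = conj_set G g (conj_set G t P)"
      using g(1) tc Pc t(2) by (simp add: conj_set_conj_set m_assoc)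
    then show "conj_set G t' (conj_set G g P) \<subseteq> conj_set G g P"
      using conj_set_mono[OF normP[OF t(1)]] by simp
  qed
  then show ?thesis unfolding eq card_conj_set[OF g(1) Qc] .
qed

lemma sylow_mark_realized:
  obtains b where "b \<in> carrier (burnside_ring G)"
    "\<And>H. subgroup H G \<Longrightarrow> burnside_mark H b = sylow_mark G p S a H"
proof (rule burnside_of_marks[OF finite_G, of "sylow_mark G p S a"])
  fix q K Q n assume "prime (q :: nat)" "subgroup K G" "subgroup Q G" "card Q = q ^ n"
    "\<And>t. t \<in> Q \<Longrightarrow> conj_set G t K \<subseteq> K"
  then show "int (card Q) dvd (\<Sum>t\<in>Q. sylow_mark G p S a (generate G (insert t K)))"
    using sylow_mark_congruence_coprime sylow_mark_congruence_p by (cases "q = p") blast+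
next
  fix b assume "b \<in> carrier (burnside_ring G)"
    "\<And>K. subgroup K G \<Longrightarrow> burnside_mark K b = sylow_mark G p S a K"
  then show thesis by (rule that)
qed (rule sylow_mark_conj_set)

end

section \<open>Restriction to the Sylow subgroup and the two inclusions\<close>

lemma burnside_mark_res:
  assumes "subgroup S G" "P \<subseteq> S" "b \<in> carrier (burnside_ring G)"
  shows "burnside_mark P (burnside_res G S b) = burnside_mark P b"
proof -
  obtain A B :: "('a, nat) gset" where AB: "fin_gset G A" "fin_gset G B" "b = gset_class G A B"
    using assms(3) by (rule burnside_carrierE)
  have "P \<subseteq> carrier G" using assms(1,2) subgroup.subset by blast
  then show ?thesis
    using fin_gset_res[OF AB(1) assms(1)] fin_gset_res[OF AB(2) assms(1)] assms(2) AB
    by (simp add: burnside_res_class[OF assms(1)] burnside_mark_class)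
qed

theorem theorem7p1:
  fixes G (structure) and p :: nat and S
  assumes "group G" and "finite (carrier G)" and "prime p" and "sylow_subgroup G p S"
  shows "burnside_res G S ` carrier (burnside_ring G) =
         burnside_fusion (G\<lparr>carrier := S\<rparr>) (fusion_system G S)"
proof
  interpret group G by fact
  have S: "subgroup S G" using assms(4) by (simp add: sylow_subgroup_def)
  note Sc = subgroup.subset[OF S]
  have ob: "P \<subseteq> S \<and> subgroup P G" if "P \<in> Ob (fusion_system G S)" for P
    using that incl_subgroup[OF S] subgroup.subset by (fastforce simp: fusion_system_def)
  show "burnside_res G S ` carrier (burnside_ring G)
      \<subseteq> burnside_fusion (G\<lparr>carrier := S\<rparr>) (fusion_system G S)"
  proof
    fix x assume "x \<in> burnside_res G S ` carrier (burnside_ring G)"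
    then obtain b where b: "b \<in> carrier (burnside_ring G)" "x = burnside_res G S b" by blast
    obtain A B :: "('a, nat) gset" where AB: "fin_gset G A" "fin_gset G B" "b = gset_class G A B"
      using b(1) by (rule burnside_carrierE)
    \<comment> \<open>Marks of a restriction are marks of \<open>b\<close> itself, and those are
      constant on conjugacy classes of \<open>G\<close>.\<close>
    have "burnside_mark P x = burnside_mark Q x"
      if P: "P \<in> Ob (fusion_system G S)" and Q: "Q \<in> Ob (fusion_system G S)"
        and iso: "fusion_iso (fusion_system G S) P Q" for P Q
    proof -
      obtain g where g: "g \<in> carrier G" "Q = conj_set G g P"
        using iso unfolding fusion_iso_iff[OF assms(1) S P Q] conj_set_def by blast
      have Pc: "P \<subseteq> carrier G" "Q \<subseteq> carrier G" using ob[OF P] ob[OF Q] Sc by auto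
      show ?thesis
        using burnside_mark_res[OF S _ b(1)] ob[OF P] ob[OF Q] AB b(2) Pc
          card_fixed_conj[OF AB(1) g(1) Pc(1)] card_fixed_conj[OF AB(2) g(1) Pc(1)]
        by (simp add: burnside_mark_class flip: g(2))
    qed
    then show "x \<in> burnside_fusion (G\<lparr>carrier := S\<rparr>) (fusion_system G S)"
      using ring_hom_closed[OF res_hom[OF S assms(1)] b(1)] b(2) by (simp add: burnside_fusion_def)
  qed
  show "burnside_fusion (G\<lparr>carrier := S\<rparr>) (fusion_system G S)
      \<subseteq> burnside_res G S ` carrier (burnside_ring G)"
  proof
    fix a assume "a \<in> burnside_fusion (G\<lparr>carrier := S\<rparr>) (fusion_system G S)"
    then interpret fusion_element G p S a by unfold_locales (use assms in auto)
    obtain b where b: "b \<in> carrier (burnside_ring G)"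
      "\<And>H. subgroup H G \<Longrightarrow> burnside_mark H b = sylow_mark G p S a H"
      by (rule sylow_mark_realized) blast
    \<comment> \<open>Both elements have the same mark at every subgroup of \<open>S\<close>, where
      \<open>sylow_mark\<close> returns the mark of \<open>a\<close>.\<close>
    have "a = burnside_res G S b"
    proof (rule burnside_eq_of_marks)
      show "finite (carrier (G\<lparr>carrier := S\<rparr>))" using finite_subset[OF Sc assms(2)] by simp
      show "a \<in> carrier (burnside_ring (G\<lparr>carrier := S\<rparr>))" by (rule a_carrier)
      show "burnside_res G S b \<in> carrier (burnside_ring (G\<lparr>carrier := S\<rparr>))"
        by (rule ring_hom_closed[OF res_hom[OF S assms(1)] b(1)])
      fix P assume P: "subgroup P (G\<lparr>carrier := S\<rparr>)"
      have P': "subgroup P G" "P \<subseteq> S" using incl_subgroup[OF S P] subgroup.subset[OF P] by auto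
      show "burnside_mark P a = burnside_mark P (burnside_res G S b)"
        using burnside_mark_res[OF S P'(2) b(1)] b(2)[OF P'(1)] sylow_mark_self[OF P'] by simp
    qed
    then show "a \<in> burnside_res G S ` carrier (burnside_ring G)" using b(1) by blast
  qed
qed

end
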